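(* Let $n\ge 5$ be odd and $m=\frac{2^n+1}{3}$. Let $\ell\ge 1$ be such that $\rho_{\ell+1}=(1,1,k)$, i.e. $\rho_{\ell+1}=5m+8k$, for some integer $0\le k<m$. Then $$d_{ORD}(C_\ell(P_\infty))=\begin{cases} 4, & \text{if } k=0,\\ 5, & \text{if } 1\le k\le\lfloor\frac{m}{8}\rfloor,\\ 6, & \text{if } \frac{m}{8}<k\le\lfloor\frac{m}{4}\rfloor,\\ 8, & \text{if } \frac{m}{4}<k\le\lfloor\frac{m}{2}\rfloor,\\ 8\left(\lceil k-\frac{m}{2}\rceil+1\right), & \text{if } \lceil\frac{m}{2}\rceil\le k\le\lfloor\frac{3m}{4}\rfloor-2,\\ 2\left(\lceil\frac{m}{4}+k\rceil+1\right)+6\left(\lceil\frac{m}{4}+k\rceil-m+1\right), & \text{if } \lfloor\frac{3m}{4}\rfloor-1\le k\le m-2,\\ 4m, & \text{if } k=m-1.\end{cases}$$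
   Context: Let $n\ge5$ be odd, $m=(2^n+1)/3$, and let $GGS(2,n)$ be (the nonsingular model of) the curve $X^2+X=Y^{3}$, $Y^{4}-Y=Z^m$; it is $\mathbb F_{2^{2n}}$-maximal of genus $g=\frac{9m-7}{2}$ and has a unique point at infinity $P_\infty$. The Weierstrass semigroup $H(P_\infty)$ (the set of $r\ge 0$ such that some rational function has pole divisor $rP_\infty$) is known to be $$H(P_\infty)=\{3im+2jm+8k \mid i\in\{0,1\},\ j\in\{0,1,2,3\},\ k\ge0\},$$ and each element has a unique such representation; $(i,j,k)$ denotes the element $3im+2jm+8k$. Write $H(P_\infty)=\{\rho_1=0<\rho_2<\rho_3<\cdots\}$. For $\ell\ge1$, $\nu_\ell$ is the number of ordered pairs $(a,b)\in H(P_\infty)\times H(P_\infty)$ with $a+b=\rho_{\ell+1}$. Let $\overline D$ be the sum of all $\mathbb F_{2^{2n}}$-rational points other than $P_\infty$, and $C_\ell(P_\infty)=C^\perp(\overline D,\rho_\ell P_\infty)$ the dual of the one-point AG code obtained by evaluating $\mathcal L(\rho_\ell P_\infty)$ at the points of $\overline D$. The order bound (Feng-Rao designed minimum distance) is $d_{ORD}(C_\ell(P_\infty))=\min\{\nu_r\mid r\ge\ell\}$. *)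

theory Defs
  imports "HOL-Algebra.Algebraic_Closure_Type" "HOL-Algebra.Generated_Fields" "HOL-Library.Infinite_Set"
begin

section \<open>Places of a function field\<close>

text \<open>
  The function field is a type \<open>'a\<close> of class \<^class>\<open>field\<close>; \<open>amb\<close> is the same field as a
  HOL-Algebra record, so that subrings, subfields and generated fields are those of the library.
\<close>

abbreviation amb :: "'a::field ring" where
  "amb \<equiv> ring_of_type_algebra"

text \<open>
  A place (a point of the nonsingular model) is represented by its valuation ring.
  The disjunction below is harmless at \<open>f = 0\<close>, since \<open>inverse 0 = 0\<close>.
\<close>

definition places :: "'a::field set \<Rightarrow> 'a set set" where
  "places K = {V. subring V amb \<and> K \<subset> V \<and> V \<subset> UNIV \<and> (\<forall>f. f \<in> V \<or> inverse f \<in> V)}"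

definition place_units :: "'a::field set \<Rightarrow> 'a set" where
  "place_units V = {u \<in> V. u \<noteq> 0 \<and> inverse u \<in> V}"

definition uniformizer :: "'a::field set \<Rightarrow> 'a \<Rightarrow> bool" where
  "uniformizer V t \<longleftrightarrow> V - place_units V = {t * v |v. v \<in> V}"

text \<open>
  \<open>has_pole_divisor K f r P\<close>: the pole divisor of \<open>f\<close> is \<open>r P\<close>, i.e. \<open>v\<^sub>P(f) = -r\<close> and \<open>f\<close> is
  regular at every other place. The first conjunct forces \<open>f \<noteq> 0\<close>.
\<close>

definition has_pole_divisor :: "'a::field set \<Rightarrow> 'a \<Rightarrow> nat \<Rightarrow> 'a set \<Rightarrow> bool" where
  "has_pole_divisor K f r P \<longleftrightarrow>
     (\<exists>t. uniformizer P t \<and> f * t ^ r \<in> place_units P) \<and> (\<forall>Q \<in> places K - {P}. f \<in> Q)"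

definition weierstrass_semigroup :: "'a::field set \<Rightarrow> 'a set \<Rightarrow> nat set" where
  "weierstrass_semigroup K P = {r. \<exists>f. has_pole_divisor K f r P}"


section \<open>The curve GGS(2,n)\<close>

text \<open>
  \<open>K\<close> is the field with \<open>2\<^bsup>2n\<^esup>\<close> elements and \<open>'a\<close> is the function field \<open>K(x,y,z)\<close> of the
  curve. Transcendence of \<open>z\<close> says that \<open>(x,y,z)\<close> is the generic point: the curve is irreducible,
  so its coordinate ring is a one-dimensional domain, and any further relation between \<open>x\<close>, \<open>y\<close>, \<open>z\<close>
  would make \<open>z\<close> algebraic over \<open>K\<close>. The division by 3 is exact for odd \<open>n\<close>.
\<close>

definition ggs_function_field :: "nat \<Rightarrow> 'a::field set \<Rightarrow> 'a \<Rightarrow> 'a \<Rightarrow> 'a \<Rightarrow> bool" where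
  "ggs_function_field n K x y z \<longleftrightarrow>
     subfield K amb \<and> card K = 2 ^ (2 * n) \<and>
     x ^ 2 + x = y ^ 3 \<and> y ^ 4 - y = z ^ ((2 ^ n + 1) div 3) \<and>
     ring.transcendental amb K z \<and>
     generate_field amb (K \<union> {x, y, z}) = UNIV"

definition point_at_infinity :: "'a::field set \<Rightarrow> 'a \<Rightarrow> 'a \<Rightarrow> 'a \<Rightarrow> 'a set \<Rightarrow> bool" where
  "point_at_infinity K x y z P \<longleftrightarrow> P \<in> places K \<and> \<not> {x, y, z} \<subseteq> P"


section \<open>The order bound\<close>

text \<open>
  All of the following depend only on the semigroup \<open>H\<close>; the numbering is 1-based, \<open>rho H 1 = 0\<close>.
  In \<open>d_ORD\<close> the infimum of a nonempty set of natural numbers is its minimum; \<open>d_ORD H l\<close> with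
  \<open>H = H(P)\<close> is the designed distance of the code \<open>C\<^sub>l(P)\<close>.
\<close>

definition rho :: "nat set \<Rightarrow> nat \<Rightarrow> nat" where
  "rho H l = enumerate H (l - 1)"

definition nu :: "nat set \<Rightarrow> nat \<Rightarrow> nat" where
  "nu H l = card {(a, b). a \<in> H \<and> b \<in> H \<and> a + b = rho H (l + 1)}"

definition d_ORD :: "nat set \<Rightarrow> nat \<Rightarrow> nat" where
  "d_ORD H l = Inf {nu H r |r. l \<le> r}"

end

theory Submission
  imports Defs "HOL-Computational_Algebra.Polynomial"
begin

text \<open>
  With \<open>w = y\<^sup>2 + y\<close> the function field is a tower of three quadratic Artin--Schreier extensions of
  \<open>K(z)\<close>: \<open>w\<^sup>2 + w = z\<^sup>m\<close>, \<open>y\<^sup>2 + y = w\<close>, \<open>x\<^sup>2 + x = y\<^sup>3\<close>. At a place with a pole of \<open>z\<close>, the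
  functions \<open>z, w, y, x\<close> have pole orders \<open>8, 4m, 2m, 3m\<close> with respect to
  \<open>s = x / z\<^bsup>2^(n-3)\<^esup>\<close>, so the eight monomials \<open>w\<^sup>l y\<^sup>j x\<^sup>i\<close> (\<open>i, j, l \<le> 1\<close>) have distinct pole
  orders modulo 8, and the pole order of every function can be read off its coordinates. In
  particular there is only one such place \<open>P\<close>. A function that is regular at all other places is
  integral over \<open>A = K[z, w, y, x]\<close>, since a non-integral \<open>f\<close> is avoided by some valuation ring
  that contains \<open>A\<close>. The ring \<open>A\<close> is integrally closed: the powers \<open>f\<^bsup>2^k\<^esup>\<close> of an integral \<open>f\<close>
  have a common denominator, in characteristic 2 so do the corresponding powers of the
  coordinates of \<open>f\<close>, and this forces them into \<open>K[z]\<close>. Hence the Weierstrass semigroup consists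
  of the pole orders of the elements of \<open>A\<close>.

  The numbers \<open>\<nu>\<close> are computed from the least elements of the semigroup in the residue classes
  modulo 8. On each class \<open>\<nu>\<close> is increasing, so the order bound is a minimum of eight numbers.
\<close>

section \<open>Subrings and valuation rings of a field\<close>

lemma subring_amb_iff:
  "subring V amb \<longleftrightarrow> 1 \<in> V \<and> (\<forall>a\<in>V. \<forall>b\<in>V. a - b \<in> V \<and> a * b \<in> V)"
  for V :: "'a::field set"
proof -
  interpret F: field "amb :: 'a ring" by (rule field_from_type_algebra)
  have neg: "\<ominus>\<^bsub>amb\<^esub> a = - a" for a :: 'a
    by (rule F.minus_equality) (auto simp: ring_of_type_algebra_def)
  show ?thesis
  proof
    assume "subring V amb"
    from subringE[OF this] show "1 \<in> V \<and> (\<forall>a\<in>V. \<forall>b\<in>V. a - b \<in> V \<and> a * b \<in> V)"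
      unfolding neg by (auto simp: ring_of_type_algebra_def) (metis diff_conv_add_uminus)
  next
    assume V: "1 \<in> V \<and> (\<forall>a\<in>V. \<forall>b\<in>V. a - b \<in> V \<and> a * b \<in> V)"
    then have z: "0 \<in> V" by (metis diff_self)
    then have n: "- a \<in> V" if "a \<in> V" for a using V that by (metis diff_0)
    then have "a + b \<in> V" if "a \<in> V" "b \<in> V" for a b
      using V that by (metis diff_minus_eq_add)
    then show "subring V amb"
      using V n by (intro F.subringI) (auto simp: neg, auto simp: ring_of_type_algebra_def)
  qed
qed

context
  fixes V :: "'a::field set"
  assumes V: "subring V amb"
begin

lemma subring_one: "1 \<in> V"
  and subring_diff: "a \<in> V \<Longrightarrow> b \<in> V \<Longrightarrow> a - b \<in> V"
  and subring_mult: "a \<in> V \<Longrightarrow> b \<in> V \<Longrightarrow> a * b \<in> V"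
  using V by (auto simp: subring_amb_iff)

lemma subring_zero: "0 \<in> V"
  using subring_diff[OF subring_one subring_one] by simp

lemma subring_uminus: "a \<in> V \<Longrightarrow> - a \<in> V"
  using subring_diff[OF subring_zero] by force

lemma subring_add: "a \<in> V \<Longrightarrow> b \<in> V \<Longrightarrow> a + b \<in> V"
  using subring_diff[OF _ subring_uminus] by force

lemma subring_power: "a \<in> V \<Longrightarrow> a ^ k \<in> V"
  by (induction k) (auto simp: subring_one subring_mult)

lemma subring_sum: "(\<And>i. i \<in> I \<Longrightarrow> f i \<in> V) \<Longrightarrow> sum f I \<in> V"
  by (induction I rule: infinite_finite_induct) (auto simp: subring_zero subring_add)

lemmas subring_closed = subring_one subring_diff subring_mult subring_zero subring_uminus
  subring_add subring_power

end

lemma subfield_amb: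
  fixes K :: "'a::field set"
  assumes "subfield K amb"
  shows "subring K amb" and "a \<in> K \<Longrightarrow> inverse a \<in> K"
proof -
  show K: "subring K amb" using subfieldE(1)[OF assms] .
  assume a: "a \<in> K"
  interpret F: field "amb :: 'a ring" by (rule field_from_type_algebra)
  show "inverse a \<in> K"
  proof (cases "a = 0")
    case False
    then have "inv\<^bsub>amb\<^esub> a = inverse a"
      by (intro F.comm_inv_char) (auto simp: ring_of_type_algebra_def)
    moreover have "inv\<^bsub>amb\<^esub> a \<in> K"
      using F.subfield_m_inv(1)[OF assms] a False by (auto simp: ring_of_type_algebra_def)
    ultimately show ?thesis by simp
  qed (use subring_zero[OF K] in simp)
qed

lemma generate_field_amb_eq_UNIV:
  fixes S :: "'a::field set"
  assumes "generate_field amb S = UNIV"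
    and "subring L amb" and "S \<subseteq> L" and inv: "\<And>a. a \<in> L \<Longrightarrow> a \<noteq> 0 \<Longrightarrow> inverse a \<in> L"
  shows "L = UNIV"
proof -
  interpret F: field "amb :: 'a ring" by (rule field_from_type_algebra)
  have "inv\<^bsub>amb\<^esub> a = inverse a" if "a \<noteq> 0" for a :: 'a
    using that by (intro F.comm_inv_char) (auto simp: ring_of_type_algebra_def)
  then have "subfield L amb"
    using assms(2) inv by (intro F.subfieldI') (auto simp: ring_of_type_algebra_def)
  then show ?thesis
    using F.generate_field_min_subfield1[of S L] assms(1,3)
    by (auto simp: ring_of_type_algebra_def)
qed

text \<open>Translation by 1 permutes \<open>K\<close>, so adding 1 to every term leaves the sum
  over \<open>K\<close> unchanged. Hence \<open>card K\<close> is 0 in the field, and a vanishing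
  power of two forces \<open>2 = 0\<close>.\<close>

lemma subfield_char_two:
  fixes K :: "'a::field set"
  assumes K: "subfield K amb" and card: "card K = 2 ^ k" and "k > 0"
  shows "(2::'a) = 0"
proof -
  note R = subfield_amb(1)[OF K]
  have "a \<in> (\<lambda>a. a + 1) ` K" if "a \<in> K" for a
    using subring_diff[OF R that subring_one[OF R]] by (intro image_eqI[of _ _ "a - 1"]) auto
  then have img: "(\<lambda>a. a + 1) ` K = K"
    using subring_add[OF R _ subring_one[OF R]] by auto
  have "(\<Sum>a\<in>K. a) = (\<Sum>a\<in>(\<lambda>a. a + 1) ` K. a)" by (simp only: img)
  also have "\<dots> = (\<Sum>a\<in>K. a + 1)" by (subst sum.reindex) (auto simp: o_def)
  finally have "of_nat (card K) = (0::'a)" by (simp add: sum.distrib)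
  then show ?thesis by (simp add: card)
qed

section \<open>Polynomials with coefficients in a subring, and the ring \<open>B[u]\<close>\<close>

definition polys_over :: "'a::field set \<Rightarrow> 'a poly set" where
  "polys_over B = {p. \<forall>i. coeff p i \<in> B}"

definition adjoin :: "'a::field set \<Rightarrow> 'a \<Rightarrow> 'a set" where
  "adjoin B u = (\<lambda>p. poly p u) ` polys_over B"

context
  fixes B :: "'a::field set"
  assumes B: "subring B amb"
begin

lemma polys_over_const: "c \<in> B \<Longrightarrow> [:c:] \<in> polys_over B"
  by (auto simp: polys_over_def coeff_pCons subring_zero[OF B] split: nat.split)

lemma polys_over_pCons: "pCons c p \<in> polys_over B \<longleftrightarrow> c \<in> B \<and> p \<in> polys_over B"
  unfolding polys_over_def by (auto simp: coeff_pCons split: nat.splits)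

lemma polys_over_monom: "c \<in> B \<Longrightarrow> monom c i \<in> polys_over B"
  by (auto simp: polys_over_def subring_zero[OF B])

lemma polys_over_add: "p \<in> polys_over B \<Longrightarrow> q \<in> polys_over B \<Longrightarrow> p + q \<in> polys_over B"
  by (auto simp: polys_over_def subring_add[OF B])

lemma polys_over_diff: "p \<in> polys_over B \<Longrightarrow> q \<in> polys_over B \<Longrightarrow> p - q \<in> polys_over B"
  by (auto simp: polys_over_def subring_diff[OF B])

lemma polys_over_mult: "p \<in> polys_over B \<Longrightarrow> q \<in> polys_over B \<Longrightarrow> p * q \<in> polys_over B"
  by (auto simp: polys_over_def coeff_mult intro!: subring_sum[OF B] subring_mult[OF B])

lemma polys_over_0: "0 \<in> polys_over B" and polys_over_1: "1 \<in> polys_over B"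
  using polys_over_const[of 0] polys_over_const[of 1] subring_closed[OF B] by (auto simp: one_pCons)

lemma polys_over_reflect: "p \<in> polys_over B \<Longrightarrow> reflect_poly p \<in> polys_over B"
  by (auto simp: polys_over_def coeff_reflect_poly subring_zero[OF B])

lemmas polys_over_closed = polys_over_0 polys_over_1 polys_over_const polys_over_monom
  polys_over_add polys_over_diff polys_over_mult

lemma subring_adjoin: "subring (adjoin B u) amb"
  unfolding subring_amb_iff
proof (intro conjI ballI)
  show "1 \<in> adjoin B u"
    unfolding adjoin_def by (rule image_eqI[of _ _ 1]) (auto simp: polys_over_1)
  fix a b assume "a \<in> adjoin B u" "b \<in> adjoin B u"
  then obtain p q where p: "p \<in> polys_over B" "a = poly p u" and q: "q \<in> polys_over B" "b = poly q u"
    by (auto simp: adjoin_def)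
  show "a - b \<in> adjoin B u"
    unfolding adjoin_def by (rule image_eqI[of _ _ "p - q"]) (auto simp: p q polys_over_diff)
  show "a * b \<in> adjoin B u"
    unfolding adjoin_def by (rule image_eqI[of _ _ "p * q"]) (auto simp: p q polys_over_mult)
qed

lemma subset_adjoin: "B \<subseteq> adjoin B u"
proof
  fix c assume "c \<in> B"
  then show "c \<in> adjoin B u"
    unfolding adjoin_def by (intro image_eqI[of _ _ "[:c:]"]) (auto simp: polys_over_const)
qed

lemma mem_adjoin: "u \<in> adjoin B u"
  unfolding adjoin_def
  by (rule image_eqI[of _ _ "[:0, 1:]"]) (auto simp: polys_over_pCons polys_over_0 subring_closed[OF B])

text \<open>Multiplying a polynomial expression in \<open>1 / u\<close> by
  \<open>u ^ degree p\<close> reverses the order of its coefficients.\<close>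

lemma adjoin_inverse:
  assumes "a \<in> adjoin B (inverse u)" "u \<noteq> 0"
  obtains p where "p \<in> polys_over B" "a * u ^ degree p = poly (reflect_poly p) u"
  using assms by (auto simp: adjoin_def poly_reflect_poly_nz mult.commute)

lemma poly_closed: "p \<in> polys_over B \<Longrightarrow> u \<in> B \<Longrightarrow> poly p u \<in> B"
  by (induction p) (auto simp: polys_over_pCons subring_closed[OF B])

end

text \<open>Weaker than membership in \<open>places K\<close>: no constant field is fixed and
  \<open>UNIV\<close> is allowed. This suits the ring produced by Zorn's lemma, whose construction
  does not involve \<open>K\<close>.\<close>

definition valuation_ring :: "'a::field set \<Rightarrow> bool" where
  "valuation_ring V \<longleftrightarrow> subring V amb \<and> (\<forall>f. f \<in> V \<or> inverse f \<in> V)"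

lemma one_minus_power_ideal:
  assumes V: "subring V amb" and "g \<in> V" "v \<in> V"
  shows "\<exists>v'\<in>V. (1 - g * v) ^ k = 1 - g * v'"
proof (induction k)
  case 0
  show ?case by (rule bexI[of _ 0]) (auto simp: subring_zero[OF V])
next
  case (Suc k)
  then obtain v' where v': "v' \<in> V" "(1 - g * v) ^ k = 1 - g * v'" by blast
  have "(1 - g * v) ^ Suc k = 1 - g * (v' + v - g * v * v')"
    by (simp add: v' algebra_simps)
  then show ?case using v' assms by (metis subring_add subring_diff subring_mult)
qed

text \<open>A subring maximal among those that contain \<open>A\<close> and avoid \<open>f\<close>
  is a valuation ring. It contains \<open>1 / f\<close>, which generates a proper ideal
  \<open>I\<close>, and every outside \<open>u\<close> satisfies a relation \<open>p(u) = 1\<close>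
  with coefficients in \<open>I\<close>. If \<open>u\<close> and \<open>1 / u\<close> were both
  outside, their shortest relations would yield a still shorter one.\<close>

lemma exists_valuation_ring_avoiding:
  fixes A :: "'a::field set"
  assumes A: "subring A amb" and f: "inverse f \<in> A" "f \<notin> A"
  obtains V where "valuation_ring V" "A \<subseteq> V" "f \<notin> V"
proof -
  define \<C> where "\<C> = {V. subring V amb \<and> A \<subseteq> V \<and> f \<notin> V}"
  have "\<exists>M\<in>\<C>. \<forall>N\<in>\<C>. M \<subseteq> N \<longrightarrow> N = M"
  proof (rule subset_Zorn_nonempty)
    show "\<C> \<noteq> {}" using A f by (auto simp: \<C>_def)
    fix C assume C: "C \<noteq> {}" "subset.chain \<C> C"
    have ch: "subring U amb" "A \<subseteq> U" "f \<notin> U" if "U \<in> C" for U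
      using C(2) that by (auto simp: subset_chain_def \<C>_def)
    have "subring (\<Union>C) amb"
      unfolding subring_amb_iff
    proof (intro conjI ballI)
      show "1 \<in> \<Union>C" using C(1) ch(1) subring_one by blast
      fix a b assume "a \<in> \<Union>C" "b \<in> \<Union>C"
      then obtain U1 U2 where U: "U1 \<in> C" "U2 \<in> C" "a \<in> U1" "b \<in> U2" by blast
      then have "U1 \<subseteq> U2 \<or> U2 \<subseteq> U1" using C(2) by (auto simp: subset_chain_def)
      then obtain U where "U \<in> C" "a \<in> U" "b \<in> U" using U by blast
      then show "a - b \<in> \<Union>C" "a * b \<in> \<Union>C"
        using ch(1) subring_diff subring_mult by blast+
    qed
    moreover have "A \<subseteq> \<Union>C" "f \<notin> \<Union>C" using C(1) ch by blast+
    ultimately show "\<Union>C \<in> \<C>" by (simp add: \<C>_def)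
  qed
  then obtain V where V_mem: "V \<in> \<C>" and V_max: "\<forall>N\<in>\<C>. V \<subseteq> N \<longrightarrow> N = V"
    by (rule bexE)
  then have V: "subring V amb" "A \<subseteq> V" "f \<notin> V"
    by (auto simp: \<C>_def)
  have max: "N = V" if "subring N amb" "V \<subseteq> N" "f \<notin> N" for N
    using V_max V(2) that by (auto simp: \<C>_def)
  define g where "g = inverse f"
  have "f \<noteq> 0" using f(2) subring_zero[OF A] by auto
  then have g: "g \<in> V" "g * f = 1" "g \<noteq> 0"
    using f(1) V(2) by (auto simp: g_def)
  define I where "I = {g * v |v. v \<in> V}"
  have one_notin: "1 \<notin> I"
  proof
    assume "1 \<in> I"
    then obtain v where "v \<in> V" "1 = g * v" by (auto simp: I_def)
    then have "v = f" using g by (metis mult_left_cancel)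
    then show False using \<open>v \<in> V\<close> V by simp
  qed
  have I_V: "I \<subseteq> V" using g by (auto simp: I_def subring_mult[OF V(1)])
  have I0: "0 \<in> I" unfolding I_def using subring_zero[OF V(1)] by force
  have I_mult: "a * b \<in> I" "b * a \<in> I" if a: "a \<in> I" and b: "b \<in> V" for a b
  proof -
    from a obtain v where v: "a = g * v" "v \<in> V" by (auto simp: I_def)
    then have "a * b = g * (v * b)" "v * b \<in> V"
      using b subring_mult[OF V(1)] by (simp_all add: mult.assoc)
    then show "a * b \<in> I" by (auto simp: I_def)
    then show "b * a \<in> I" by (simp add: mult.commute)
  qed
  have I_add: "a + b \<in> I" if "a \<in> I" "b \<in> I" for a b
    using that subring_add[OF V(1)] unfolding I_def by (force simp: distrib_left[symmetric])
  \<comment> \<open>Adjoining an outside element gives a strictly larger ring, which by maximality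
    no longer avoids \<open>f\<close>.\<close>
  have max': "f \<in> adjoin V u" if "u \<notin> V" for u
    using max[OF subring_adjoin[OF V(1)] subset_adjoin[OF V(1)]] mem_adjoin[OF V(1)] that by metis
  have rel: "\<exists>p. (\<forall>i. coeff p i \<in> I) \<and> poly p u = 1" if "u \<notin> V" for u
  proof -
    from max'[OF that] obtain p where "p \<in> polys_over V" "f = poly p u"
      by (auto simp: adjoin_def)
    then have "(\<forall>i. coeff (smult g p) i \<in> I) \<and> poly (smult g p) u = 1"
      using g by (auto simp: I_def polys_over_def)
    then show ?thesis by blast
  qed
  \<comment> \<open>Otherwise \<open>f\<close> lies in \<open>V[1 / (1 - a)]\<close>, and clearing
    denominators puts a power of \<open>1 - a\<close> into \<open>I\<close>, although that power is
    congruent to 1 modulo \<open>I\<close>.\<close>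
  have unit: "inverse (1 - a) \<in> V" if a: "a \<in> I" for a
  proof (rule ccontr)
    assume n: "inverse (1 - a) \<notin> V"
    have nz: "1 - a \<noteq> 0" using a one_notin by auto
    obtain p where p: "p \<in> polys_over V" "f * (1 - a) ^ degree p = poly (reflect_poly p) (1 - a)"
      using adjoin_inverse[OF V(1) max'[OF n] nz] .
    have "1 - a \<in> V" using a I_V subring_closed[OF V(1)] by blast
    then have "f * (1 - a) ^ degree p \<in> V"
      unfolding p(2) by (intro poly_closed[OF V(1)] polys_over_reflect[OF V(1)] p(1))
    then have "g * (f * (1 - a) ^ degree p) \<in> I" by (auto simp: I_def)
    then have "(1 - a) ^ degree p \<in> I" using g by (simp add: mult.assoc[symmetric])
    moreover obtain v where v: "a = g * v" "v \<in> V" using a by (auto simp: I_def)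
    obtain v' where "v' \<in> V" "(1 - a) ^ degree p = 1 - g * v'"
      using one_minus_power_ideal[OF V(1) g(1) v(2)] v(1) by blast
    ultimately have "(1 - g * v') + g * v' \<in> I"
      by (intro I_add) (auto simp: I_def)
    then show False using one_notin by simp
  qed
  text \<open>A shortest relation for the inverse of \<open>u\<close> rewrites the leading term of a shortest
    relation for \<open>u\<close> if the latter is at least as long.\<close>
  have shorten: "\<exists>p'. (\<forall>i. coeff p' i \<in> I) \<and> poly p' u = 1 \<and> degree p' < degree p"
    if u: "u \<noteq> 0" and p: "\<forall>i. coeff p i \<in> I" "poly p u = 1"
      and q: "\<forall>i. coeff q i \<in> I" "poly q (inverse u) = 1" and le: "degree q \<le> degree p" for u p q
  proof -
    define d where "d = degree q"
    define w where "w = 1 - coeff q 0"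
    have q0: "coeff q 0 \<in> I" using q(1) by blast
    then have w: "inverse w \<in> V" "w \<noteq> 0" using unit[OF q0] one_notin by (auto simp: w_def)
    have "d \<noteq> 0"
    proof
      assume "d = 0"
      then obtain c where "q = [:c:]" unfolding d_def by (rule degree_eq_zeroE)
      then show False using q(2) q0 one_notin by simp
    qed
    \<comment> \<open>Multiplied by \<open>u ^ d\<close>, the relation \<open>q(1 / u) = 1\<close>
      equates \<open>w * u ^ d\<close> with terms of degree below \<open>d\<close>. As
      \<open>w\<close> is a unit, \<open>r\<close> expresses \<open>u ^ d\<close> by lower powers
      with coefficients in \<open>I\<close>.\<close>
    define r where "r = smult (inverse w) (reflect_poly q - monom (coeff q 0) d)"
    have rI: "coeff r i \<in> I" for i
      using q I_mult(2)[OF _ w(1)] I0 by (auto simp: r_def coeff_reflect_poly d_def)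
    have r_deg: "coeff r i = 0" if "i \<ge> d" for i
      using that by (auto simp: r_def coeff_reflect_poly d_def)
    have "poly (reflect_poly q) u = u ^ d"
      using poly_reflect_poly_nz[OF u, of q] q by (simp add: d_def)
    then have "poly r u = inverse w * (u ^ d - coeff q 0 * u ^ d)"
      by (simp add: r_def poly_monom)
    also have "\<dots> = inverse w * w * u ^ d" by (simp add: w_def algebra_simps)
    finally have r_u: "poly r u = u ^ d" using w by simp
    define N where "N = degree p"
    define p' where "p' = (p - monom (coeff p N) N) + monom (coeff p N) (N - d) * r"
    have "coeff p N * coeff r j \<in> I" for j
      using p(1) rI I_V by (intro I_mult(1)) auto
    then have "coeff p' i \<in> I" for i
      unfolding p'_def coeff_add coeff_monom_mult using p(1) I0
      by (intro I_add) auto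
    moreover have "u ^ (N - d) * u ^ d = u ^ N"
      using le by (simp add: N_def d_def flip: power_add)
    then have "poly p' u = 1"
      using p(2) by (simp add: p'_def poly_monom r_u mult.assoc)
    moreover have "coeff p' i = 0" if "i \<ge> N" for i
      using that le r_deg[of "i - (N - d)"]
      by (auto simp: p'_def coeff_monom_mult N_def d_def coeff_eq_0)
    then have "degree p' \<le> N - 1" by (intro degree_le) auto
    moreover have "N > 0" using le \<open>d \<noteq> 0\<close> by (simp add: N_def d_def)
    ultimately show ?thesis
      by (intro exI[of _ p']) (auto simp: N_def)
  qed
  have "u \<in> V \<or> inverse u \<in> V" for u
  proof (rule ccontr)
    assume "\<not> (u \<in> V \<or> inverse u \<in> V)"
    then have n: "u \<notin> V" "inverse u \<notin> V" by auto
    then have u: "u \<noteq> 0" using subring_zero[OF V(1)] by auto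
    define Q where "Q u p \<longleftrightarrow> (\<forall>i. coeff p i \<in> I) \<and> poly p u = 1" for u p
    have ex: "\<exists>p. Q u p \<and> (\<forall>q. Q u q \<longrightarrow> degree p \<le> degree q)" if u: "u \<notin> V" for u
    proof -
      obtain p where "Q u p" using rel[OF u] by (auto simp: Q_def)
      then show ?thesis by (rule ex_has_least_nat)
    qed
    have Q_shorten: "\<exists>p'. Q u p' \<and> degree p' < degree p"
      if "u \<noteq> 0" "Q u p" "Q (inverse u) q" "degree q \<le> degree p" for u p q
      using shorten[of u p q] that by (auto simp: Q_def)
    obtain p where p: "Q u p" "\<And>p'. Q u p' \<Longrightarrow> degree p \<le> degree p'"
      using ex[OF n(1)] by blast
    obtain q where q: "Q (inverse u) q" "\<And>q'. Q (inverse u) q' \<Longrightarrow> degree q \<le> degree q'"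
      using ex[OF n(2)] by blast
    show False
    proof (cases "degree q \<le> degree p")
      case True
      then show False using Q_shorten[OF u p(1) q(1)] p(2) by (meson linorder_not_less)
    next
      case False
      then show False using Q_shorten[of "inverse u" q p] u p(1) q by (simp, meson linorder_not_less)
    qed
  qed
  then show thesis
    using that V by (auto simp: valuation_ring_def)
qed

section \<open>Units of a valuation ring\<close>

context
  fixes V :: "'a::field set"
  assumes V: "valuation_ring V"
begin

lemma valuation_subring: "subring V amb"
  using V by (simp add: valuation_ring_def)

lemmas V_closed = subring_closed[OF valuation_subring]

lemma valuation_inverse: "f \<notin> V \<Longrightarrow> inverse f \<in> V"
  using V by (auto simp: valuation_ring_def)

lemma unit_one: "1 \<in> place_units V"
  by (simp add: place_units_def V_closed)

lemma unit_mult: "u \<in> place_units V \<Longrightarrow> v \<in> place_units V \<Longrightarrow> u * v \<in> place_units V"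
  by (simp add: place_units_def V_closed inverse_mult_distrib)

lemma unit_inverse: "u \<in> place_units V \<Longrightarrow> inverse u \<in> place_units V"
  by (simp add: place_units_def)

lemma unit_divide: "u \<in> place_units V \<Longrightarrow> v \<in> place_units V \<Longrightarrow> u / v \<in> place_units V"
  by (simp add: divide_inverse unit_mult unit_inverse)

lemma unit_power: "u \<in> place_units V \<Longrightarrow> u ^ k \<in> place_units V"
  by (induction k) (auto simp: unit_one unit_mult)

lemma root_mem: "a ^ 2 \<in> V \<Longrightarrow> a \<in> V"
proof (rule ccontr)
  assume a: "a ^ 2 \<in> V" "a \<notin> V"
  then have "a ^ 2 * inverse a \<in> V" by (intro V_closed(3) valuation_inverse)
  moreover have "a ^ 2 * inverse a = a" by (cases "a = 0") (simp_all add: power2_eq_square)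
  ultimately show False using a(2) by metis
qed

lemma root_unit: "a ^ 2 \<in> place_units V \<Longrightarrow> a \<in> place_units V"
  using root_mem[of a] root_mem[of "inverse a"] by (auto simp: place_units_def power_inverse)

text \<open>Division by \<open>u\<close> reduces this to inverting \<open>1 + e\<close>. For nonzero
  \<open>e\<close> the inverse of \<open>e / (1 + e)\<close> is \<open>1 + 1 / e\<close>, which is
  outside \<open>V\<close> because \<open>e\<close> is no unit; so \<open>e / (1 + e)\<close> is in
  \<open>V\<close>, and with it \<open>1 / (1 + e)\<close>.\<close>

lemma unit_add_nonunit:
  assumes u: "u \<in> place_units V" and d: "d \<in> V" "d \<notin> place_units V"
  shows "u + d \<in> place_units V"
proof -
  define e where "e = d / u"
  have u': "u \<noteq> 0" "u \<in> V" "inverse u \<in> V" using u by (auto simp: place_units_def)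
  then have d_eq: "d = e * u" and e: "e \<in> V"
    using d by (auto simp: e_def divide_inverse V_closed)
  have e_nonunit: "e \<notin> place_units V" using d u unit_mult d_eq by metis
  have ne: "1 + e \<noteq> 0"
  proof
    assume "1 + e = 0"
    then have "e = - 1" by (simp add: add_eq_0_iff)
    then show False using e_nonunit by (simp add: place_units_def V_closed)
  qed
  have "e / (1 + e) \<in> V"
  proof (cases "e = 0")
    case False
    have "inverse (e / (1 + e)) = 1 + inverse e"
      using False ne by (simp add: field_simps)
    moreover have "1 + inverse e \<notin> V"
    proof
      assume "1 + inverse e \<in> V"
      then have "(1 + inverse e) - 1 \<in> V" by (intro V_closed(1,2))
      then show False using e_nonunit e False by (simp add: place_units_def)
    qed
    ultimately show ?thesis using valuation_inverse by metis
  qed (simp add: V_closed)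
  then have "1 - e / (1 + e) \<in> V" by (intro V_closed)
  moreover have "1 - e / (1 + e) = inverse (1 + e)" using ne by (simp add: field_simps)
  ultimately have "1 + e \<in> place_units V"
    using ne e by (simp add: place_units_def V_closed)
  then have "u * (1 + e) \<in> place_units V" by (rule unit_mult[OF u])
  then show ?thesis by (simp add: d_eq algebra_simps)
qed

text \<open>The quotient is \<open>1 + 1 / t\<close>, and \<open>1 / t\<close> is a nonunit. So at a
  pole of \<open>t\<close> the order of \<open>t ^ 2 + t\<close> is that of \<open>t ^ 2\<close>,
  the source of all pole orders in the tower.\<close>

lemma artin_schreier_unit:
  assumes "t \<notin> V"
  shows "(t ^ 2 + t) / t ^ 2 \<in> place_units V"
proof -
  have t: "t \<noteq> 0" using assms V_closed by auto
  have "1 + inverse t \<in> place_units V"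
    using assms valuation_inverse by (intro unit_add_nonunit unit_one) (auto simp: place_units_def)
  moreover have "(t ^ 2 + t) / t ^ 2 = 1 + inverse t"
    using t by (simp add: field_simps power2_eq_square)
  ultimately show ?thesis by simp
qed

lemma artin_schreier_mem_iff: "t ^ 2 + t \<in> V \<longleftrightarrow> t \<in> V"
proof
  assume as: "t ^ 2 + t \<in> V"
  show "t \<in> V"
  proof (rule ccontr)
    assume t: "t \<notin> V"
    then have "(t ^ 2 + t) * inverse ((t ^ 2 + t) / t ^ 2) \<in> V"
      using as artin_schreier_unit[OF t] by (intro V_closed(3)) (auto simp: place_units_def)
    moreover have "t \<noteq> 0" using t V_closed by auto
    moreover have "t ^ 2 + t \<noteq> 0" using artin_schreier_unit[OF t] by (auto simp: place_units_def)
    ultimately have "t ^ 2 \<in> V" by simp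
    then show False using t root_mem by blast
  qed
qed (auto simp: V_closed)

end

text \<open>The pole order of \<open>f\<close>, with \<open>s\<close> in the role of the inverse of
  a uniformizer. No discrete valuation is presupposed: that every nonzero \<open>f\<close> has a
  degree is proved for the curve only.\<close>

definition has_degree :: "'a::field set \<Rightarrow> 'a \<Rightarrow> 'a \<Rightarrow> int \<Rightarrow> bool" where
  "has_degree V s f r \<longleftrightarrow> f / s powi r \<in> place_units V"

section \<open>Arithmetic of pole orders\<close>

context
  fixes V :: "'a::field set" and s :: 'a
  assumes V: "valuation_ring V" and s: "s \<notin> V"
begin

lemma s_nonzero: "s \<noteq> 0"
  using s V_closed[OF V] by auto

lemma powi_mem_iff: "s powi r \<in> V \<longleftrightarrow> r \<le> 0"
proof
  assume mem: "s powi r \<in> V"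
  show "r \<le> 0"
  proof (rule ccontr)
    assume "\<not> r \<le> 0"
    then obtain k where k: "r = int (Suc k)" by (metis gr0_implies_Suc not_le zero_less_imp_eq_int)
    have "s ^ Suc k \<in> V" using mem unfolding k power_int_of_nat .
    moreover have "inverse s ^ k \<in> V" using valuation_inverse[OF V s] by (rule V_closed(7)[OF V])
    ultimately have "s ^ Suc k * inverse s ^ k \<in> V" by (rule V_closed(3)[OF V])
    moreover have "s ^ Suc k * inverse s ^ k = s"
      using s_nonzero by (simp add: power_inverse)
    ultimately show False using s by metis
  qed
next
  assume "r \<le> 0"
  then have "s powi r = inverse s ^ nat (- r)"
    by (cases "r = 0") (auto simp: power_int_def power_inverse)
  then show "s powi r \<in> V" using valuation_inverse[OF V s] by (simp add: V_closed[OF V])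
qed

lemma has_degree_nonzero: "has_degree V s f r \<Longrightarrow> f \<noteq> 0"
  by (auto simp: has_degree_def place_units_def)

lemma has_degree_mult:
  "has_degree V s f r \<Longrightarrow> has_degree V s g r' \<Longrightarrow> has_degree V s (f * g) (r + r')"
  using unit_mult[OF V, of "f / s powi r" "g / s powi r'"] s_nonzero
  by (simp add: has_degree_def power_int_add)

lemma has_degree_divide:
  "has_degree V s f r \<Longrightarrow> has_degree V s g r' \<Longrightarrow> has_degree V s (f / g) (r - r')"
  using unit_divide[OF V, of "f / s powi r" "g / s powi r'"] s_nonzero
  by (simp add: has_degree_def power_int_diff field_simps)

lemma has_degree_unit_iff: "has_degree V s f 0 \<longleftrightarrow> f \<in> place_units V"
  by (simp add: has_degree_def)

lemma has_degree_self: "has_degree V s s 1"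
  using s_nonzero by (simp add: has_degree_def unit_one[OF V])

lemma has_degree_power: "has_degree V s f r \<Longrightarrow> has_degree V s (f ^ k) (int k * r)"
proof (induction k)
  case (Suc k)
  then show ?case using has_degree_mult[OF Suc.prems Suc.IH] by (simp add: algebra_simps)
qed (simp add: has_degree_unit_iff unit_one[OF V])

lemma has_degree_cong_unit: "has_degree V s g r \<Longrightarrow> f / g \<in> place_units V \<Longrightarrow> has_degree V s f r"
  using has_degree_mult[of "f / g" 0 g r] has_degree_nonzero[of g r]
  by (simp add: has_degree_unit_iff)

lemma has_degree_root:
  assumes "has_degree V s (f ^ 2) (2 * r)"
  shows "has_degree V s f r"
proof -
  have "s powi (2 * r) = (s powi r) ^ 2"
    unfolding mult_2 power2_eq_square by (rule power_int_add) (simp add: s_nonzero)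
  then have "(f / s powi r) ^ 2 \<in> place_units V"
    using assms by (simp add: has_degree_def power_divide)
  then show ?thesis using root_unit[OF V] by (simp add: has_degree_def)
qed

lemma has_degree_mem_iff:
  assumes "has_degree V s f r"
  shows "f \<in> V \<longleftrightarrow> r \<le> 0"
proof -
  have u: "f / s powi r \<in> V" "inverse (f / s powi r) \<in> V" "f \<noteq> 0"
    using assms by (auto simp: has_degree_def place_units_def)
  have nz: "s powi r \<noteq> 0" using s_nonzero by simp
  have "f \<in> V" if "s powi r \<in> V"
    using V_closed(3)[OF V u(1) that] nz by (simp split: if_splits)
  moreover have "s powi r \<in> V" if "f \<in> V"
    using V_closed(3)[OF V u(2) that] u(3) nz by (simp add: field_simps)
  ultimately show ?thesis using powi_mem_iff by blast
qed

lemma has_degree_unique: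
  assumes "has_degree V s f r" "has_degree V s f r'"
  shows "r = r'"
  using has_degree_mem_iff[OF has_degree_divide[OF assms]] V_closed(1)[OF V]
    has_degree_mem_iff[OF has_degree_divide[OF assms(2,1)]] has_degree_nonzero[OF assms(1)]
  by simp

text \<open>Strict triangle inequality: \<open>g / s powi r\<close> has negative degree, hence is a
  nonunit of \<open>V\<close>, and a unit plus a nonunit is a unit.\<close>

lemma has_degree_add_less:
  assumes f: "has_degree V s f r" and g: "has_degree V s g r'" and less: "r' < r"
  shows "has_degree V s (f + g) r"
proof -
  have "has_degree V s (s powi r) r"
    using s_nonzero by (simp add: has_degree_def unit_one[OF V])
  then have d: "has_degree V s (g / s powi r) (r' - r)" by (rule has_degree_divide[OF g])
  have "g / s powi r \<in> V" using has_degree_mem_iff[OF d] less by simp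
  moreover have "g / s powi r \<notin> place_units V"
    using has_degree_unique[OF d, of 0] less by (auto simp: has_degree_unit_iff)
  ultimately have "f / s powi r + g / s powi r \<in> place_units V"
    using f by (intro unit_add_nonunit[OF V]) (auto simp: has_degree_def)
  then show ?thesis by (simp add: has_degree_def add_divide_distrib)
qed

end

text \<open>\<open>\<Omega>\<close> will be the set of places at infinity, which is not known to be a singleton at first:
  a degree that does not depend on the place shows that it is one.\<close>

definition has_degrees_in :: "'a::field set set \<Rightarrow> 'a \<Rightarrow> 'a set \<Rightarrow> int set \<Rightarrow> bool" where
  "has_degrees_in \<Omega> s B T \<longleftrightarrow> (\<forall>f\<in>B. f \<noteq> 0 \<longrightarrow> (\<exists>r\<in>T. \<forall>V\<in>\<Omega>. has_degree V s f r))"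

text \<open>If \<open>t ^ 2 + t\<close> lies in \<open>B\<close>, the module spanned by 1 and
  \<open>t\<close> is already the ring \<open>B[t]\<close>.\<close>

definition artin_schreier_ext :: "'a::field set \<Rightarrow> 'a \<Rightarrow> 'a set" where
  "artin_schreier_ext B t = {a + b * t |a b. a \<in> B \<and> b \<in> B}"

text \<open>The degrees of \<open>a\<close> and \<open>b * t\<close> lie in \<open>T\<close> and in
  \<open>T\<close> shifted by \<open>e\<close>. By \<open>disj\<close> they differ, so nothing
  cancels and the larger one is the degree of the sum.\<close>

lemma has_degrees_in_ext:
  fixes B :: "'a::field set"
  assumes \<Omega>: "\<And>V. V \<in> \<Omega> \<Longrightarrow> valuation_ring V \<and> s \<notin> V"
    and B: "has_degrees_in \<Omega> s B T" and t: "\<And>V. V \<in> \<Omega> \<Longrightarrow> has_degree V s t e"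
    and disj: "\<And>r r'. r \<in> T \<Longrightarrow> r' \<in> T \<Longrightarrow> r \<noteq> r' + e"
  shows "has_degrees_in \<Omega> s (artin_schreier_ext B t) (T \<union> (\<lambda>r. r + e) ` T)"
  unfolding has_degrees_in_def
proof (intro ballI impI)
  fix f assume "f \<in> artin_schreier_ext B t" and f0: "f \<noteq> 0"
  then obtain a b where f: "f = a + b * t" "a \<in> B" "b \<in> B" by (auto simp: artin_schreier_ext_def)
  have a: "\<exists>r\<in>T. \<forall>V\<in>\<Omega>. has_degree V s a r" if "a \<noteq> 0"
    using that B f by (auto simp: has_degrees_in_def)
  have b: "\<exists>r\<in>T. \<forall>V\<in>\<Omega>. has_degree V s (b * t) (r + e)" if "b \<noteq> 0"
  proof -
    obtain r where r: "r \<in> T" "\<forall>V\<in>\<Omega>. has_degree V s b r"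
      using \<open>b \<noteq> 0\<close> B f by (auto simp: has_degrees_in_def)
    have "has_degree V s (b * t) (r + e)" if "V \<in> \<Omega>" for V
      using \<Omega>[OF that] r(2) t[OF that] that by (intro has_degree_mult) auto
    then show ?thesis using r(1) by blast
  qed
  show "\<exists>r\<in>T \<union> (\<lambda>r. r + e) ` T. \<forall>V\<in>\<Omega>. has_degree V s f r"
  proof (cases "a = 0 \<or> b = 0")
    case True
    then show ?thesis
    proof
      assume "a = 0"
      then have "f = b * t" "b \<noteq> 0" using f f0 by auto
      then show ?thesis using b by blast
    next
      assume "b = 0"
      then have "f = a" "a \<noteq> 0" using f f0 by auto
      then show ?thesis using a by blast
    qed
  next
    case False
    then obtain r r' where r: "r \<in> T" "\<forall>V\<in>\<Omega>. has_degree V s a r"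
      and r': "r' \<in> T" "\<forall>V\<in>\<Omega>. has_degree V s (b * t) (r' + e)"
      using a b by blast
    have "r' + e < r \<or> r < r' + e" using disj[OF r(1) r'(1)] by linarith
    then show ?thesis
    proof
      assume "r' + e < r"
      then have "has_degree V s f r" if "V \<in> \<Omega>" for V
        using that r r' \<Omega>[OF that] unfolding f(1) by (intro has_degree_add_less) auto
      then show ?thesis using r(1) by blast
    next
      assume "r < r' + e"
      then have "has_degree V s f (r' + e)" if "V \<in> \<Omega>" for V
        using that r r' \<Omega>[OF that] unfolding f(1) add.commute[of a] by (intro has_degree_add_less) auto
      then show ?thesis using r'(1) by blast
    qed
  qed
qed

section \<open>Quadratic Artin--Schreier towers\<close>

lemma add_power_char_two:
  assumes "(2::'a::field) = 0"
  shows "(a + b) ^ 2 ^ k = a ^ 2 ^ k + (b::'a) ^ 2 ^ k"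
proof (induction k)
  case (Suc k)
  have "(a + b) ^ 2 ^ Suc k = ((a + b) ^ 2 ^ k) ^ 2"
    by (simp add: power_mult[symmetric] mult.commute)
  also have "\<dots> = (a ^ 2 ^ k) ^ 2 + (b ^ 2 ^ k) ^ 2"
    unfolding Suc by (simp add: power2_sum assms)
  finally show ?case by (simp add: power_mult[symmetric] mult.commute)
qed simp

context
  fixes B :: "'a::field set" and t :: 'a
  assumes B: "subring B amb" and t: "t ^ 2 + t \<in> B"
begin

lemma mem_ext: "a \<in> B \<Longrightarrow> b \<in> B \<Longrightarrow> a + b * t \<in> artin_schreier_ext B t"
  by (auto simp: artin_schreier_ext_def)

lemma subring_ext: "subring (artin_schreier_ext B t) amb"
  unfolding subring_amb_iff
proof (intro conjI ballI)
  show "1 \<in> artin_schreier_ext B t"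
    using mem_ext[of 1 0] subring_closed[OF B] by simp
  fix f g assume "f \<in> artin_schreier_ext B t" "g \<in> artin_schreier_ext B t"
  then obtain a b c d where f: "f = a + b * t" "a \<in> B" "b \<in> B" and g: "g = c + d * t" "c \<in> B" "d \<in> B"
    by (auto simp: artin_schreier_ext_def)
  have diff: "f - g = (a - c) + (b - d) * t" by (simp add: f g algebra_simps)
  show "f - g \<in> artin_schreier_ext B t"
    unfolding diff using f g by (intro mem_ext) (auto simp: subring_closed[OF B])
  have mult: "f * g = (a * c + b * d * (t ^ 2 + t)) + (a * d + b * c - b * d) * t"
    by (simp add: f g algebra_simps power2_eq_square)
  show "f * g \<in> artin_schreier_ext B t"
    unfolding mult using f g t by (intro mem_ext) (auto simp: subring_closed[OF B])
qed

lemma subset_ext: "B \<subseteq> artin_schreier_ext B t"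
  using mem_ext[of _ 0] subring_closed[OF B] by auto

lemma generator_mem_ext: "t \<in> artin_schreier_ext B t"
  using mem_ext[of 0 1] subring_closed[OF B] by simp

end

definition has_multiples_in :: "'a::field set \<Rightarrow> 'a set \<Rightarrow> bool" where
  "has_multiples_in B0 B \<longleftrightarrow> (\<forall>b\<in>B. b \<noteq> 0 \<longrightarrow> (\<exists>c\<in>B. b * c \<in> B0 \<and> b * c \<noteq> 0))"

text \<open>\<open>f'\<close> is the conjugate of \<open>f\<close> under \<open>t -> t + 1\<close>,
  and the norm \<open>f * f'\<close> falls into \<open>B\<close>. If \<open>f'\<close> vanishes,
  then \<open>f = - b\<close> is in \<open>B\<close> itself.\<close>

lemma has_multiples_in_ext:
  fixes B :: "'a::field set"
  assumes two: "(2::'a) = 0" and B: "subring B amb" and t: "t ^ 2 + t \<in> B"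
    and mult: "has_multiples_in B0 B"
  shows "has_multiples_in B0 (artin_schreier_ext B t)"
  unfolding has_multiples_in_def
proof (intro ballI impI)
  fix f assume f: "f \<in> artin_schreier_ext B t" "f \<noteq> 0"
  then obtain a b where ab: "f = a + b * t" "a \<in> B" "b \<in> B" by (auto simp: artin_schreier_ext_def)
  define f' where "f' = (a + b) + b * t"
  have f': "f' \<in> artin_schreier_ext B t"
    unfolding f'_def using ab by (intro mem_ext[OF B t]) (auto simp: subring_closed[OF B])
  note R = subring_ext[OF B t]
  show "\<exists>c\<in>artin_schreier_ext B t. f * c \<in> B0 \<and> f * c \<noteq> 0"
  proof (cases "f' = 0")
    case True
    then have "f = - b" by (simp add: ab(1) f'_def algebra_simps eq_neg_iff_add_eq_0)
    then have "f \<in> B" using ab by (simp add: subring_closed[OF B])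
    then show ?thesis using mult f(2) subset_ext[OF B t] by (auto simp: has_multiples_in_def)
  next
    case False
    have "f * f' = a ^ 2 + a * b + b ^ 2 * (t ^ 2 + t) + 2 * (a * b * t)"
      by (simp add: ab(1) f'_def algebra_simps power2_eq_square)
    then have "f * f' = a ^ 2 + a * b + b ^ 2 * (t ^ 2 + t)" using two by simp
    then have "f * f' \<in> B" using ab t by (simp add: subring_closed[OF B])
    moreover have "f * f' \<noteq> 0" using False f by simp
    ultimately obtain c where c: "c \<in> B" "f * f' * c \<in> B0" "f * f' * c \<noteq> 0"
      using mult unfolding has_multiples_in_def by blast
    have "f' * c \<in> artin_schreier_ext B t"
      using f' c(1) subset_ext[OF B t] by (intro subring_mult[OF R]) auto
    then show ?thesis using c by (intro bexI[of _ "f' * c"]) (auto simp: mult.assoc)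
  qed
qed

definition fractions :: "'a::field set \<Rightarrow> 'a set \<Rightarrow> 'a set" where
  "fractions B B0 = {g / h |g h. g \<in> B \<and> h \<in> B0 \<and> h \<noteq> 0}"

text \<open>Only the exponents \<open>2 ^ k\<close> are considered: these powers are additive in
  characteristic 2, so the condition passes to coordinates.\<close>

definition almost_integral :: "'a::field set \<Rightarrow> 'a set \<Rightarrow> 'a \<Rightarrow> bool" where
  "almost_integral B0 B f \<longleftrightarrow> (\<exists>H\<in>B0. H \<noteq> 0 \<and> (\<forall>k. f ^ 2 ^ k * H \<in> B))"

definition almost_integrally_closed :: "'a::field set \<Rightarrow> 'a set \<Rightarrow> bool" where
  "almost_integrally_closed B0 B \<longleftrightarrow> (\<forall>f\<in>fractions B B0. almost_integral B0 B f \<longrightarrow> f \<in> B)"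

text \<open>In characteristic 2 the square of \<open>t + c\<close> is
  \<open>t + (t ^ 2 + t) + c ^ 2\<close>, so iterated squaring moves \<open>t\<close> only by
  elements of \<open>B\<close>.\<close>

lemma artin_schreier_power:
  assumes two: "(2::'a::field) = 0" and B: "subring B amb" and t: "t ^ 2 + t \<in> B"
  shows "\<exists>c\<in>B. t ^ 2 ^ k = t + (c::'a)"
proof (induction k)
  case 0
  show ?case using subring_zero[OF B] by force
next
  case (Suc k)
  then obtain c where c: "c \<in> B" "t ^ 2 ^ k = t + c" by blast
  have "t ^ 2 ^ Suc k = (t ^ 2 ^ k) ^ 2" by (simp add: power_mult[symmetric] mult.commute)
  also have "\<dots> = t ^ 2 + c ^ 2 + 2 * t * c" unfolding c by (simp add: power2_sum)
  also have "\<dots> = t ^ 2 + c ^ 2 + 2 * t" using two by simp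
  also have "\<dots> = t + ((t ^ 2 + t) + c ^ 2)" by (simp only: mult_2 mult_2_right ac_simps)
  finally show ?case using c t by (meson subring_add[OF B] subring_power[OF B])
qed

text \<open>For \<open>f = a + b * t\<close> the power \<open>f ^ 2 ^ k\<close> has the coordinates
  \<open>a ^ 2 ^ k + b ^ 2 ^ k * c\<close> and \<open>b ^ 2 ^ k\<close>. The second one makes
  \<open>b\<close> almost integral, hence an element of \<open>B\<close>; then the term with
  \<open>c\<close> can be subtracted and \<open>a\<close> follows.\<close>

lemma almost_integrally_closed_ext:
  fixes B :: "'a::field set"
  assumes two: "(2::'a) = 0" and B: "subring B amb" and t: "t ^ 2 + t \<in> B"
    and B0: "subring B0 amb" "B0 \<subseteq> B"
    and free: "\<And>a b. a \<in> B \<Longrightarrow> b \<in> B \<Longrightarrow> a + b * t = 0 \<Longrightarrow> a = 0 \<and> b = 0"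
    and closed: "almost_integrally_closed B0 B"
  shows "almost_integrally_closed B0 (artin_schreier_ext B t)"
  unfolding almost_integrally_closed_def
proof (intro ballI impI)
  fix f assume "f \<in> fractions (artin_schreier_ext B t) B0" and "almost_integral B0 (artin_schreier_ext B t) f"
  then obtain g1 g2 h H where g: "g1 \<in> B" "g2 \<in> B" and h: "h \<in> B0" "h \<noteq> 0" and f: "f = (g1 + g2 * t) / h"
    and H: "H \<in> B0" "H \<noteq> 0" "\<And>k. f ^ 2 ^ k * H \<in> artin_schreier_ext B t"
    by (auto simp: fractions_def artin_schreier_ext_def almost_integral_def)
  define a b where "a = g1 / h" and "b = g2 / h"
  have frac: "a \<in> fractions B B0" "b \<in> fractions B B0"
    using g h by (auto simp: fractions_def a_def b_def)
  have f_eq: "f = a + b * t" by (simp add: f a_def b_def add_divide_distrib)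
  have HB: "H \<in> B" using H B0 by blast
  have coords: "\<exists>c\<in>B. b ^ 2 ^ k * H \<in> B \<and> (a ^ 2 ^ k + b ^ 2 ^ k * c) * H \<in> B \<and> t ^ 2 ^ k = t + c" for k
  proof -
    obtain c where c: "c \<in> B" "t ^ 2 ^ k = t + c"
      using artin_schreier_power[OF two B t] by blast
    obtain u v where uv: "u \<in> B" "v \<in> B" "f ^ 2 ^ k * H = u + v * t"
      using H(3)[of k] by (auto simp: artin_schreier_ext_def)
    \<comment> \<open>\<open>free\<close> compares coordinates only inside \<open>B\<close>. This
      factor clears the denominators of \<open>a ^ 2 ^ k\<close> and \<open>b ^ 2 ^ k\<close> and is
      cancelled afterwards.\<close>
    define \<eta> where "\<eta> = h ^ 2 ^ k"
    have \<eta>: "\<eta> \<in> B" "\<eta> \<noteq> 0" using h B0 by (auto simp: \<eta>_def subring_power[OF B])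
    have ab: "\<eta> * a ^ 2 ^ k = g1 ^ 2 ^ k" "\<eta> * b ^ 2 ^ k = g2 ^ 2 ^ k"
      using h by (simp_all add: \<eta>_def a_def b_def power_divide)
    have "u + v * t = (a ^ 2 ^ k + b ^ 2 ^ k * (t + c)) * H"
      unfolding uv(3)[symmetric] f_eq add_power_char_two[OF two] power_mult_distrib c(2) ..
    then have "\<eta> * (u + v * t) = ((\<eta> * a ^ 2 ^ k) + (\<eta> * b ^ 2 ^ k) * (t + c)) * H"
      by (simp add: algebra_simps)
    then have "(\<eta> * u - (g1 ^ 2 ^ k + g2 ^ 2 ^ k * c) * H) + (\<eta> * v - g2 ^ 2 ^ k * H) * t = 0"
      unfolding ab by (simp add: algebra_simps)
    moreover have "\<eta> * u - (g1 ^ 2 ^ k + g2 ^ 2 ^ k * c) * H \<in> B" "\<eta> * v - g2 ^ 2 ^ k * H \<in> B"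
      using \<eta> uv g HB c by (simp_all add: subring_closed[OF B])
    ultimately have "\<eta> * u = (g1 ^ 2 ^ k + g2 ^ 2 ^ k * c) * H" "\<eta> * v = g2 ^ 2 ^ k * H"
      using free by fastforce+
    then have "\<eta> * u = \<eta> * ((a ^ 2 ^ k + b ^ 2 ^ k * c) * H)" "\<eta> * v = \<eta> * (b ^ 2 ^ k * H)"
      unfolding ab[symmetric] by (simp_all add: algebra_simps)
    then have "u = (a ^ 2 ^ k + b ^ 2 ^ k * c) * H" "v = b ^ 2 ^ k * H"
      using \<eta> by simp_all
    then show ?thesis using uv c by auto
  qed
  then have "almost_integral B0 B b" using H by (auto simp: almost_integral_def)
  then have b: "b \<in> B" using closed frac by (auto simp: almost_integrally_closed_def)
  have "a ^ 2 ^ k * H \<in> B" for k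
  proof -
    obtain c where c: "c \<in> B" "(a ^ 2 ^ k + b ^ 2 ^ k * c) * H \<in> B" using coords by blast
    have "(a ^ 2 ^ k + b ^ 2 ^ k * c) * H - b ^ 2 ^ k * c * H \<in> B"
      using b c HB by (simp add: subring_closed[OF B])
    then show ?thesis by (simp add: algebra_simps)
  qed
  then have "almost_integral B0 B a" using H by (auto simp: almost_integral_def)
  then have "a \<in> B" using closed frac by (auto simp: almost_integrally_closed_def)
  then show "f \<in> artin_schreier_ext B t" using b unfolding f_eq by (intro mem_ext[OF B t])
qed

text \<open>Only the leading coefficient of \<open>d\<close> is inverted, so quotient and remainder
  keep coefficients in \<open>K\<close>. This makes the ideals of the polynomial ring over
  \<open>K\<close> principal.\<close>

lemma polys_over_division:
  fixes K :: "'a::field set"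
  assumes K: "subfield K amb" and d: "d \<in> polys_over K" "d \<noteq> 0" and "p \<in> polys_over K"
  shows "\<exists>c\<in>polys_over K. \<exists>r\<in>polys_over K. p = d * c + r \<and> (r = 0 \<or> degree r < degree d)"
proof -
  note R = subfield_amb(1)[OF K]
  have "\<exists>c\<in>polys_over K. \<exists>r\<in>polys_over K. p = d * c + r \<and> (r = 0 \<or> degree r < degree d)"
    if "p \<in> polys_over K" "p = 0 \<or> degree p < n" for p n
    using that
  proof (induction n arbitrary: p)
    case 0
    then show ?case by (intro bexI[of _ 0]) (auto simp: polys_over_0[OF R])
  next
    case (Suc n)
    show ?case
    proof (cases "p = 0 \<or> degree p < degree d")
      case True
      then show ?thesis
        using Suc.prems by (intro bexI[of _ 0] bexI[of _ p]) (auto simp: polys_over_0[OF R])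
    next
      case False
      define e where "e = monom (lead_coeff p / lead_coeff d) (degree p - degree d)"
      have e: "e \<in> polys_over K"
        using Suc.prems d subfield_amb(2)[OF K] unfolding e_def divide_inverse
        by (intro polys_over_monom[OF R] subring_mult[OF R]) (auto simp: polys_over_def)
      have nz: "lead_coeff p / lead_coeff d \<noteq> 0" using False d by simp
      then have "degree e = degree p - degree d" by (simp add: e_def degree_monom_eq)
      moreover have "e \<noteq> 0" using nz by (simp add: e_def)
      ultimately have deg: "degree (d * e) = degree p"
        using d False by (simp add: degree_mult_eq)
      moreover have "lead_coeff (d * e) = lead_coeff p"
        using d nz by (simp add: lead_coeff_mult e_def degree_monom_eq)
      ultimately have "coeff (p - d * e) (degree p) = 0" by simp
      moreover have "degree (p - d * e) \<le> degree p" using deg by (intro degree_diff_le) auto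
      ultimately have "p - d * e = 0 \<or> degree (p - d * e) < degree p"
        by (rule eq_zero_or_degree_less[rotated])
      then have "p - d * e = 0 \<or> degree (p - d * e) < n" using Suc.prems False by auto
      moreover have "p - d * e \<in> polys_over K"
        using Suc.prems d e by (simp add: polys_over_closed[OF R])
      ultimately obtain c r where cr: "c \<in> polys_over K" "r \<in> polys_over K" "p - d * e = d * c + r"
        "r = 0 \<or> degree r < degree d"
        using Suc.IH by blast
      have "p = d * (c + e) + r" using cr(3) by (simp add: algebra_simps)
      then show ?thesis using cr e polys_over_add[OF R] by blast
    qed
  qed
  from this[of p "Suc (degree p)"] show ?thesis using assms by simp
qed

text \<open>Nonzero constants are units, so in each Horner step \<open>z * poly p z\<close>
  dominates. In particular a nonzero polynomial does not vanish at \<open>z\<close>.\<close>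

lemma has_degree_poly:
  fixes K :: "'a::field set"
  assumes K: "subfield K amb" and V: "valuation_ring V" "K \<subseteq> V" "z \<notin> V"
    and p: "p \<in> polys_over K" "p \<noteq> 0"
  shows "has_degree V z (poly p z) (int (degree p))"
  using p
proof (induction p)
  case (pCons a p)
  note R = subfield_amb(1)[OF K]
  have a: "a \<in> K" and pK: "p \<in> polys_over K" using pCons.prems polys_over_pCons[OF R] by auto
  have const: "has_degree V z a 0" if "a \<noteq> 0"
    using that a subfield_amb(2)[OF K a] V by (auto simp: has_degree_unit_iff[OF V(1,3)] place_units_def)
  show ?case
  proof (cases "p = 0")
    case True
    then show ?thesis using pCons const by auto
  next
    case False
    then have "has_degree V z (z * poly p z) (1 + int (degree p))"
      using pCons.IH pK by (intro has_degree_mult[OF V(1,3)] has_degree_self[OF V(1,3)])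
    then have "has_degree V z (z * poly p z + a) (1 + int (degree p))"
      using has_degree_add_less[OF V(1,3) _ const] by (cases "a = 0") auto
    then show ?thesis using False by (simp add: add.commute)
  qed
qed simp

text \<open>For \<open>f = p / q\<close> in lowest terms, a common denominator of all
  \<open>f ^ 2 ^ k\<close> has degree at least \<open>2 ^ k * degree q\<close> for every
  \<open>k\<close>; so \<open>q\<close> is constant.\<close>

lemma almost_integrally_closed_polynomials:
  fixes K :: "'a::field set"
  assumes two: "(2::'a) = 0" and K: "subfield K amb"
    and V: "valuation_ring V" "K \<subseteq> V" "z \<notin> V"
  shows "almost_integrally_closed (adjoin K z) (adjoin K z)"
  unfolding almost_integrally_closed_def
proof (intro ballI impI)
  note R = subfield_amb(1)[OF K]
  note R0 = subring_adjoin[OF R, of z]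
  note deg = has_degree_poly[OF K V]
  have nz: "poly p z \<noteq> 0" if "p \<in> polys_over K" "p \<noteq> 0" for p
    using has_degree_nonzero[OF V(1,3) deg[OF that]] .
  have ev: "poly p z \<in> adjoin K z" if "p \<in> polys_over K" for p
    using that by (auto simp: adjoin_def)
  fix f assume "f \<in> fractions (adjoin K z) (adjoin K z)" and "almost_integral (adjoin K z) (adjoin K z) f"
  then obtain g h H where gh: "g \<in> adjoin K z" "h \<in> adjoin K z" "h \<noteq> 0" "f = g / h"
    and H: "H \<in> adjoin K z" "H \<noteq> 0" "\<And>k. f ^ 2 ^ k * H \<in> adjoin K z"
    by (auto simp: fractions_def almost_integral_def)
  define D where "D = {q \<in> polys_over K. q \<noteq> 0 \<and> poly q z * f \<in> adjoin K z}"
  obtain h' where h': "h' \<in> polys_over K" "h = poly h' z" using gh by (auto simp: adjoin_def)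
  have "h' \<in> D" using gh h' by (auto simp: D_def)
  then obtain q where q: "q \<in> D" and q_min: "\<And>q'. q' \<in> D \<Longrightarrow> degree q \<le> degree q'"
    using ex_has_least_nat[of "\<lambda>q. q \<in> D" h' degree] by blast
  have q': "q \<in> polys_over K" "q \<noteq> 0" using q by (auto simp: D_def)
  obtain p where p: "p \<in> polys_over K" "poly q z * f = poly p z"
    using q by (auto simp: D_def adjoin_def)
  \<comment> \<open>The ideal generated by \<open>p\<close> and \<open>q\<close>. Its element
    \<open>d\<close> of least degree divides both.\<close>
  define J where "J = {\<alpha> * p + \<beta> * q |\<alpha> \<beta>. \<alpha> \<in> polys_over K \<and> \<beta> \<in> polys_over K}"
  have memJ: "\<alpha> * p + \<beta> * q \<in> J" if "\<alpha> \<in> polys_over K" "\<beta> \<in> polys_over K" for \<alpha> \<beta>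
    using that by (auto simp: J_def)
  have pJ: "p \<in> J" and qJ: "q \<in> J"
    using memJ[of 1 0] memJ[of 0 1] by (simp_all add: polys_over_closed[OF R])
  obtain d where d: "d \<in> J" "d \<noteq> 0" and d_min: "\<And>e. e \<in> J \<Longrightarrow> e \<noteq> 0 \<Longrightarrow> degree d \<le> degree e"
    using ex_has_least_nat[of "\<lambda>e. e \<in> J \<and> e \<noteq> 0" q degree] qJ q'(2) by blast
  obtain \<alpha> \<beta> where ab: "\<alpha> \<in> polys_over K" "\<beta> \<in> polys_over K" "d = \<alpha> * p + \<beta> * q"
    using d(1) by (auto simp: J_def)
  have dK: "d \<in> polys_over K" using ab p q' by (simp add: polys_over_closed[OF R])
  have div: "\<exists>c\<in>polys_over K. e = d * c" if e: "e \<in> J" for e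
  proof -
    obtain \<gamma> \<delta> where cd: "\<gamma> \<in> polys_over K" "\<delta> \<in> polys_over K" "e = \<gamma> * p + \<delta> * q"
      using e by (auto simp: J_def)
    then have "e \<in> polys_over K" using p q' by (simp add: polys_over_closed[OF R])
    from polys_over_division[OF K dK d(2) this] obtain c r where cr: "c \<in> polys_over K" "r \<in> polys_over K"
      "e = d * c + r" "r = 0 \<or> degree r < degree d" by blast
    have "r = e - d * c" using cr(3) by simp
    then have "r = (\<gamma> - \<alpha> * c) * p + (\<delta> - \<beta> * c) * q"
      by (simp add: ab(3) cd(3) algebra_simps)
    moreover have "\<gamma> - \<alpha> * c \<in> polys_over K" "\<delta> - \<beta> * c \<in> polys_over K"
      using cd ab cr by (simp_all add: polys_over_closed[OF R])
    ultimately have "r \<in> J" using memJ by simp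
    then have "r = 0" using cr(4) d_min by (meson linorder_not_less)
    then show ?thesis using cr by auto
  qed
  obtain p1 q1 where p1: "p1 \<in> polys_over K" "p = d * p1" and q1: "q1 \<in> polys_over K" "q = d * q1"
    using div[OF pJ] div[OF qJ] by blast
  have dz: "poly d z \<noteq> 0" using nz[OF dK d(2)] .
  \<comment> \<open>Cancelling \<open>d\<close> gives the denominator \<open>q1\<close> of
    \<open>f\<close>, so the minimality of \<open>degree q\<close> leaves degree 0 for
    \<open>d\<close>.\<close>
  have "poly q1 z * f = poly p1 z"
    using p(2) dz unfolding p1(2) q1(2) by (simp add: mult.assoc)
  then have "q1 \<in> D" using q1 q'(2) p1 ev by (auto simp: D_def)
  then have "degree q \<le> degree q1" by (rule q_min)
  then have "degree d = 0"
    using d(2) q'(2) q1(2) by (auto simp: degree_mult_eq)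
  text \<open>Hence \<open>d\<close> is a constant, and a Bezout relation shows that \<open>1 / q\<close> is a \<open>K[z]\<close>-linear
    combination of \<open>1\<close> and \<open>f\<close>; its \<open>2\<^sup>k\<close>-th power inherits the bounded denominator of \<open>f\<close>.\<close>
  define \<phi> where "\<phi> = poly q z"
  have \<phi>: "\<phi> \<noteq> 0" using nz[OF q'] by (simp add: \<phi>_def)
  have rel: "poly d z = \<phi> * (poly \<alpha> z * f + poly \<beta> z)"
    using p(2) unfolding ab(3) by (simp add: \<phi>_def algebra_simps)
  obtain H' where H': "H' \<in> polys_over K" "H = poly H' z" using H by (auto simp: adjoin_def)
  have H'0: "H' \<noteq> 0" using H H' by auto
  have bound: "2 ^ k * degree q \<le> degree H'" for k
  proof -
    define e where "e = poly \<alpha> z ^ 2 ^ k * (f ^ 2 ^ k * H) + poly \<beta> z ^ 2 ^ k * H"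
    have "e \<in> adjoin K z"
      unfolding e_def using H(1) H(3)[of k] ev ab by (simp add: subring_closed[OF R0])
    then obtain e' where e': "e' \<in> polys_over K" "e = poly e' z" by (auto simp: adjoin_def)
    have "poly d z ^ 2 ^ k * H = \<phi> ^ 2 ^ k * e"
      unfolding rel power_mult_distrib add_power_char_two[OF two] e_def by (simp add: algebra_simps)
    then have eq: "poly (d ^ 2 ^ k * H') z = poly (q ^ 2 ^ k * e') z"
      by (simp add: H' e' \<phi>_def)
    have pw: "a ^ i \<in> polys_over K" if "a \<in> polys_over K" for a i
      using that by (induction i) (auto simp: polys_over_closed[OF R])
    have "e' \<noteq> 0"
    proof
      assume "e' = 0"
      then have "poly (d ^ 2 ^ k * H') z = 0" using eq by simp
      then show False using dz H H' by simp
    qed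
    then have "has_degree V z (poly (q ^ 2 ^ k * e') z) (int (degree (q ^ 2 ^ k * e')))"
      using q' e' pw by (intro deg) (auto simp: polys_over_closed[OF R])
    moreover have "has_degree V z (poly (d ^ 2 ^ k * H') z) (int (degree (d ^ 2 ^ k * H')))"
      using d dK H' H'0 pw by (intro deg) (auto simp: polys_over_closed[OF R])
    ultimately have "degree (q ^ 2 ^ k * e') = degree (d ^ 2 ^ k * H')"
      unfolding eq using has_degree_unique[OF V(1,3)] by fastforce
    then show ?thesis
      using q' \<open>e' \<noteq> 0\<close> d H'0 \<open>degree d = 0\<close> by (simp add: degree_mult_eq degree_power_eq)
  qed
  have "degree q = 0"
  proof (rule ccontr)
    assume "degree q \<noteq> 0"
    \<comment> \<open>The instance \<open>k = degree H'\<close> already violates the bound.\<close>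
    then have "2 ^ degree H' \<le> 2 ^ degree H' * degree q" by simp
    also have "\<dots> \<le> degree H'" by (rule bound)
    finally show False using less_exp[of "degree H'"] by simp
  qed
  then obtain c where c: "q = [:c:]" by (rule degree_eq_zeroE)
  have cK: "c \<in> K" "c \<noteq> 0" using q' c polys_over_pCons[OF R] by auto
  have "f = inverse c * poly p z" using p(2) c cK by (simp add: field_simps)
  moreover have "inverse c \<in> adjoin K z" using subfield_amb(2)[OF K cK(1)] subset_adjoin[OF R] by blast
  ultimately show "f \<in> adjoin K z" using ev[OF p(1)] subring_mult[OF R0] by simp
qed

text \<open>Membership in \<open>A[1 / f]\<close> is integrality in disguise: it gives a monic
  equation of degree \<open>N + 1\<close> for \<open>f\<close>. Powers up to \<open>N\<close> have
  the denominator \<open>h ^ N\<close>, and higher powers reduce to smaller exponents.\<close>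

lemma almost_integral_of_mem_adjoin_inverse:
  fixes A :: "'a::field set"
  assumes A: "subring A amb" and B0: "subring B0 amb" "B0 \<subseteq> A"
    and f: "f \<in> fractions A B0" "f \<noteq> 0" "f \<in> adjoin A (inverse f)"
  shows "almost_integral B0 A f"
proof -
  obtain g h where gh: "g \<in> A" "h \<in> B0" "h \<noteq> 0" "f = g / h" using f(1) by (auto simp: fractions_def)
  obtain p where p: "p \<in> polys_over A" "f * f ^ degree p = poly (reflect_poly p) f"
    using adjoin_inverse[OF A f(3,2)] .
  define N r where "N = degree p" and "r = reflect_poly p"
  define H where "H = h ^ N"
  have rA: "coeff r i \<in> A" for i
    using polys_over_reflect[OF A p(1)] by (simp add: r_def polys_over_def)
  have r_deg: "degree r \<le> N" unfolding r_def N_def by (rule degree_reflect_poly_le)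
  have hA: "h \<in> A" using gh B0 by blast
  have "f ^ k * H \<in> A" for k
  proof (induction k rule: less_induct)
    case (less k)
    show ?case
    proof (cases "k \<le> N")
      case True
      then have "f ^ k * H = g ^ k * h ^ (N - k)"
        using gh by (simp add: H_def power_divide power_diff)
      then show ?thesis using gh hA by (simp add: subring_closed[OF A])
    next
      case False
      define j where "j = k - Suc N"
      have k: "k = j + Suc N" using False by (simp add: j_def)
      have "f ^ k * H = f ^ j * poly r f * H"
        using p(2) by (simp add: k power_add r_def N_def)
      also have "\<dots> = (\<Sum>i\<le>degree r. coeff r i * (f ^ (j + i) * H))"
        unfolding poly_altdef by (simp add: sum_distrib_left sum_distrib_right power_add mult_ac)
      also have "\<dots> \<in> A"
        using r_deg k by (intro subring_sum[OF A] subring_mult[OF A rA less.IH]) auto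
      finally show ?thesis .
    qed
  qed
  moreover have "H \<in> B0" "H \<noteq> 0" using gh subring_power[OF B0(1)] by (auto simp: H_def)
  ultimately show ?thesis by (auto simp: almost_integral_def)
qed

lemma mem_of_mem_valuation_rings:
  fixes A :: "'a::field set"
  assumes A: "subring A amb" and B0: "subring B0 amb" "B0 \<subseteq> A"
    and closed: "almost_integrally_closed B0 A"
    and f: "f \<in> fractions A B0" and val: "\<And>V. valuation_ring V \<Longrightarrow> A \<subseteq> V \<Longrightarrow> f \<in> V"
  shows "f \<in> A"
proof (cases "f = 0")
  case False
  have "f \<in> adjoin A (inverse f)"
  proof (rule ccontr)
    assume "f \<notin> adjoin A (inverse f)"
    from exists_valuation_ring_avoiding[OF subring_adjoin[OF A] mem_adjoin[OF A] this]
    obtain V where "valuation_ring V" "adjoin A (inverse f) \<subseteq> V" "f \<notin> V" .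
    then show False using val subset_adjoin[OF A] by blast
  qed
  then show ?thesis
    using almost_integral_of_mem_adjoin_inverse[OF A B0 f False] closed f
    by (auto simp: almost_integrally_closed_def)
qed (simp add: subring_zero[OF A])

section \<open>The Weierstrass semigroup\<close>

definition ggs_semigroup :: "nat \<Rightarrow> nat set" where
  "ggs_semigroup m = {3 * i * m + 2 * j * m + 8 * k | i j k. i \<le> 1 \<and> j \<le> 3}"

lemma less_8_cases: "(r::nat) < 8 \<Longrightarrow> r \<in> {0, 1, 2, 3, 4, 5, 6, 7}"
  by auto

text \<open>If \<open>b\<close> were nonzero, \<open>a = - b * t\<close> would have one degree in
  \<open>T\<close> and another one in \<open>T\<close> shifted by \<open>e\<close>.\<close>

lemma has_degrees_in_free:
  fixes B :: "'a::field set"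
  assumes V: "valuation_ring V" "s \<notin> V"
    and B: "has_degrees_in \<Omega> s B T" "V \<in> \<Omega>" and t: "has_degree V s t e"
    and disj: "\<And>r r'. r \<in> T \<Longrightarrow> r' \<in> T \<Longrightarrow> r \<noteq> r' + e"
    and ab: "a \<in> B" "b \<in> B" "a + b * t = 0"
  shows "a = 0 \<and> b = 0"
proof -
  have "b = 0"
  proof (rule ccontr)
    assume b0: "b \<noteq> 0"
    then obtain r' where r': "r' \<in> T" "has_degree V s b r'"
      using B ab by (auto simp: has_degrees_in_def)
    have "has_degree V s (- 1) 0"
      by (simp add: has_degree_unit_iff[OF V] place_units_def V_closed[OF V(1)])
    then have "has_degree V s (- 1 * (b * t)) (0 + (r' + e))"
      by (intro has_degree_mult[OF V] r' t)
    moreover have "a = - 1 * (b * t)" using ab(3) by (simp add: eq_neg_iff_add_eq_0)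
    ultimately have a: "has_degree V s a (r' + e)" by simp
    then have "a \<noteq> 0" by (rule has_degree_nonzero[OF V])
    then obtain r where "r \<in> T" "has_degree V s a r"
      using B ab by (auto simp: has_degrees_in_def)
    then show False using disj r' has_degree_unique[OF V _ a] by blast
  qed
  then show ?thesis using ab by simp
qed

text \<open>For inverses, a nonzero multiple \<open>g * c\<close> in \<open>B0\<close> of the
  numerator turns \<open>h / g\<close> into \<open>(h * c) / (g * c)\<close>, whose denominator is
  admissible.\<close>

lemma fractions_subfield:
  fixes A :: "'a::field set"
  assumes A: "subring A amb" and B0: "subring B0 amb" "B0 \<subseteq> A" and mult: "has_multiples_in B0 A"
  shows "subring (fractions A B0) amb"
    and "f \<in> fractions A B0 \<Longrightarrow> f \<noteq> 0 \<Longrightarrow> inverse f \<in> fractions A B0"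
    and "A \<subseteq> fractions A B0"
proof -
  have intro: "g / h \<in> fractions A B0" if "g \<in> A" "h \<in> B0" "h \<noteq> 0" for g h
    using that by (auto simp: fractions_def)
  show sub: "A \<subseteq> fractions A B0"
    using intro[of _ 1] subring_one[OF B0(1)] by auto
  show "subring (fractions A B0) amb"
    unfolding subring_amb_iff
  proof (intro conjI ballI)
    show "1 \<in> fractions A B0" using sub subring_one[OF A] by blast
    fix f1 f2 assume "f1 \<in> fractions A B0" "f2 \<in> fractions A B0"
    then obtain g1 h1 g2 h2 where g: "g1 \<in> A" "g2 \<in> A" and h: "h1 \<in> B0" "h2 \<in> B0" "h1 \<noteq> 0" "h2 \<noteq> 0"
      and f: "f1 = g1 / h1" "f2 = g2 / h2"
      by (auto simp: fractions_def)
    have hA: "h1 \<in> A" "h2 \<in> A" using h B0 by auto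
    have "f1 - f2 = (g1 * h2 - g2 * h1) / (h1 * h2)"
      unfolding f using h by (simp add: diff_frac_eq)
    then show "f1 - f2 \<in> fractions A B0"
      using intro[of "g1 * h2 - g2 * h1" "h1 * h2"] g h hA
      by (simp add: subring_closed[OF A] subring_mult[OF B0(1)])
    have "f1 * f2 = (g1 * g2) / (h1 * h2)" using f by simp
    then show "f1 * f2 \<in> fractions A B0"
      using intro[of "g1 * g2" "h1 * h2"] g h
      by (simp add: subring_mult[OF A] subring_mult[OF B0(1)])
  qed
  assume "f \<in> fractions A B0" "f \<noteq> 0"
  then obtain g h where gh: "g \<in> A" "h \<in> B0" "h \<noteq> 0" "f = g / h" "g \<noteq> 0"
    by (auto simp: fractions_def)
  then obtain c where c: "c \<in> A" "g * c \<in> B0" "g * c \<noteq> 0"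
    using mult by (auto simp: has_multiples_in_def)
  have "inverse f = (h * c) / (g * c)" using c(3) by (simp add: gh(4))
  then show "inverse f \<in> fractions A B0"
    using intro[of "h * c" "g * c"] gh c B0 subring_mult[OF A] by auto
qed

lemma place_valuation_ring:
  assumes "V \<in> places K"
  shows "valuation_ring V" "K \<subseteq> V"
  using assms by (auto simp: places_def valuation_ring_def)

section \<open>The function field of the curve\<close>

locale ggs_curve =
  fixes n m :: nat and K :: "'a::field set" and x y z :: 'a and P :: "'a set"
  assumes n: "5 \<le> n" "odd n" and m: "m = (2 ^ n + 1) div 3"
    and ff: "ggs_function_field n K x y z" and P: "point_at_infinity K x y z P"
begin

lemma three_m: "3 * m = 2 ^ n + 1"
proof -
  have "(3::nat) dvd 2 ^ n + 1"
    using n(2)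
  proof (induction n rule: nat_induct2)
    case (step n)
    then have "(3::nat) dvd 2 ^ n + 1" by simp
    then have "(3::nat) dvd 3 * 2 ^ n + (2 ^ n + 1)" by (rule dvd_add[OF dvd_triv_left])
    moreover have "3 * 2 ^ n + (2 ^ n + 1) = 2 ^ (n + 2) + (1::nat)" by simp
    ultimately show ?case by simp
  qed auto
  then show ?thesis by (simp add: m)
qed

text \<open>As \<open>n\<close> is at least 5, \<open>3 * m\<close> is 1 more than a positive
  multiple of 32, and 3 is its own inverse modulo 8.\<close>

lemma m_mod_8: "m mod 8 = 3" and m_ge: "11 \<le> m"
proof -
  obtain t :: nat where t: "t = 2 ^ (n - 5)" by blast
  have "(2::nat) ^ n = 2 ^ (5 + (n - 5))" using n by simp
  also have "\<dots> = 32 * t" unfolding power_add t by simp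
  finally have eq: "3 * m = 32 * t + 1" using three_m by simp
  have "3 * (m mod 8) mod 8 = 1" unfolding mod_mult_right_eq eq by presburger
  then show "m mod 8 = 3" using less_8_cases[of "m mod 8"] by auto
  have "1 \<le> t" by (simp add: t)
  then show "11 \<le> m" using eq by linarith
qed

lemma K: "subfield K amb" and K_ring: "subring K amb" and two: "(2::'a) = 0"
proof -
  show K: "subfield K amb" using ff by (simp add: ggs_function_field_def)
  then show "subring K amb" by (rule subfield_amb)
  show "(2::'a) = 0" using subfield_char_two[OF K, of "2 * n"] ff n by (simp add: ggs_function_field_def)
qed

definition w :: 'a where "w = y ^ 2 + y"
text \<open>The numerator has pole order \<open>3 * m\<close>, the denominator
  \<open>8 * 2 ^ (n - 3) = 2 ^ n\<close>. They differ by 1, so \<open>s\<close> has a simple pole at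
  infinity.\<close>

definition s :: 'a where "s = x / z ^ (2 ^ (n - 3))"

lemma x_rel: "x ^ 2 + x = y ^ 3" and w_rel: "w ^ 2 + w = z ^ m"
proof -
  show "x ^ 2 + x = y ^ 3" using ff by (simp add: ggs_function_field_def)
  have "y ^ 4 - y = z ^ m" using ff m by (simp add: ggs_function_field_def)
  moreover have "w ^ 2 + w = y ^ 4 - y + 2 * (y ^ 3 + y ^ 2 + y)"
    by (simp add: w_def power2_eq_square eval_nat_numeral algebra_simps)
  ultimately show "w ^ 2 + w = z ^ m" using two by simp
qed

text \<open>Regularity climbs the tower from \<open>z\<close> to \<open>w\<close>, \<open>y\<close>
  and \<open>x\<close>, so a point at infinity must be a pole of \<open>z\<close>.\<close>

lemma mem_of_z_mem:
  assumes V: "valuation_ring V" and "z \<in> V"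
  shows "w \<in> V" "y \<in> V" "x \<in> V"
proof -
  show "w \<in> V"
    using artin_schreier_mem_iff[OF V, of w] assms by (simp add: w_rel V_closed)
  then show "y \<in> V"
    using artin_schreier_mem_iff[OF V, of y] by (simp add: w_def)
  then show "x \<in> V"
    using artin_schreier_mem_iff[OF V, of x] V by (simp add: x_rel V_closed)
qed

lemma P_place: "P \<in> places K" and z_notin_P: "z \<notin> P"
proof -
  show "P \<in> places K" using P by (simp add: point_at_infinity_def)
  then show "z \<notin> P"
    using P mem_of_z_mem[of P] place_valuation_ring(1) by (auto simp: point_at_infinity_def)
qed

section \<open>Pole orders of \<open>z\<close>, \<open>w\<close>, \<open>y\<close>, \<open>x\<close>
  at a pole of \<open>z\<close>\<close>

context
  fixes V assumes V: "valuation_ring V" and zV: "z \<notin> V"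
begin

lemma power_notin: "a \<notin> V \<Longrightarrow> k \<noteq> 0 \<Longrightarrow> a ^ k \<notin> V"
  using has_degree_mem_iff[OF V _ has_degree_power[OF V _ has_degree_self[OF V]], of a k] by simp

lemma notin: "w \<notin> V" "y \<notin> V" "x \<notin> V"
proof -
  have "w ^ 2 + w \<notin> V" unfolding w_rel using power_notin[OF zV, of m] m_ge by simp
  then show w: "w \<notin> V" unfolding artin_schreier_mem_iff[OF V] .
  then show y: "y \<notin> V" unfolding w_def artin_schreier_mem_iff[OF V] .
  have "x ^ 2 + x \<notin> V" unfolding x_rel by (rule power_notin[OF y]) simp
  then show "x \<notin> V" unfolding artin_schreier_mem_iff[OF V] .
qed

lemma units: "w ^ 2 / z ^ m \<in> place_units V" "y ^ 2 / w \<in> place_units V" "x ^ 2 / y ^ 3 \<in> place_units V"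
  using unit_inverse[OF V artin_schreier_unit[OF V notin(1)]] unit_inverse[OF V artin_schreier_unit[OF V notin(2)]]
    unit_inverse[OF V artin_schreier_unit[OF V notin(3)]]
  unfolding w_rel x_rel w_def[symmetric] by simp_all

lemma nonzero: "x \<noteq> 0" "y \<noteq> 0" "z \<noteq> 0" "w \<noteq> 0"
  using notin zV V_closed(4)[OF V] by auto

text \<open>\<open>3 m = 2\<^sup>n + 1\<close> turns \<open>s\<^sup>8\<close>, a unit multiple of \<open>z\<^bsup>3m\<^esup> / z\<^bsup>2^n\<^esup>\<close>, into a unit multiple
  of \<open>z\<close>.\<close>
lemma s_notin: "s \<notin> V" and degree_z: "has_degree V s z 8"
proof -
  have "(2::nat) ^ n = 2 ^ (3 + (n - 3))" using n by simp
  then have "(2::nat) ^ n = 2 ^ (n - 3) * 8" by (simp only: power_add) simp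
  then have s8: "s ^ 8 = x ^ 8 / z ^ (2 ^ n)"
    by (simp add: s_def power_divide power_mult[symmetric])
  have "z ^ (2 ^ n) * z = z ^ (3 * m)" by (simp add: three_m)
  then have "s ^ 8 / z = x ^ 8 / (z ^ m) ^ 3"
    by (simp add: s8 power_mult[symmetric] mult.commute)
  also have "\<dots> = (x ^ 2 / y ^ 3) ^ 4 * (y ^ 2 / w) ^ 6 * (w ^ 2 / z ^ m) ^ 3"
    using nonzero by (simp add: power_divide power_mult[symmetric])
  also have "\<dots> \<in> place_units V"
    by (intro unit_mult[OF V] unit_power[OF V] units)
  finally have u: "s ^ 8 / z \<in> place_units V" .
  show s: "s \<notin> V"
  proof
    assume "s \<in> V"
    then have "s ^ 8 * inverse (s ^ 8 / z) \<in> V"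
      using u by (intro V_closed(3)[OF V] V_closed(7)[OF V]) (auto simp: place_units_def)
    moreover have "s ^ 8 * inverse (s ^ 8 / z) = z"
      using nonzero by (simp add: s_def)
    ultimately show False using zV by simp
  qed
  have "z / s ^ 8 \<in> place_units V" using unit_inverse[OF V u] by simp
  moreover have "s powi 8 = s ^ 8" using power_int_of_nat[of s 8] by simp
  ultimately show "has_degree V s z 8" by (simp add: has_degree_def)
qed

lemma degree_w: "has_degree V s w (4 * int m)"
proof (rule has_degree_root[OF V s_notin])
  show "has_degree V s (w ^ 2) (2 * (4 * int m))"
    using has_degree_cong_unit[OF V s_notin has_degree_power[OF V s_notin degree_z, of m] units(1)]
    by (simp add: mult.commute)
qed

lemma degree_y: "has_degree V s y (2 * int m)"
proof (rule has_degree_root[OF V s_notin])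
  show "has_degree V s (y ^ 2) (2 * (2 * int m))"
    using has_degree_cong_unit[OF V s_notin degree_w units(2)] by simp
qed

lemma degree_x: "has_degree V s x (3 * int m)"
proof (rule has_degree_root[OF V s_notin])
  show "has_degree V s (x ^ 2) (2 * (3 * int m))"
    using has_degree_cong_unit[OF V s_notin has_degree_power[OF V s_notin degree_y, of 3] units(3)]
    by simp
qed

end

section \<open>The tower from \<open>K[z]\<close> to the coordinate ring \<open>A\<close>, with the
  degrees of its elements\<close>

definition B0 where "B0 = adjoin K z"
definition B1 where "B1 = artin_schreier_ext B0 w"
definition B2 where "B2 = artin_schreier_ext B1 y"
definition A where "A = artin_schreier_ext B2 x"

definition \<Omega> where "\<Omega> = {V \<in> places K. z \<notin> V}"

definition T0 :: "int set" where "T0 = {8 * int k |k. True}"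
definition T1 where "T1 = T0 \<union> (\<lambda>r. r + 4 * int m) ` T0"
definition T2 where "T2 = T1 \<union> (\<lambda>r. r + 2 * int m) ` T1"
definition T3 where "T3 = T2 \<union> (\<lambda>r. r + 3 * int m) ` T2"

lemma \<Omega>: "V \<in> \<Omega> \<Longrightarrow> valuation_ring V" "V \<in> \<Omega> \<Longrightarrow> z \<notin> V" "V \<in> \<Omega> \<Longrightarrow> valuation_ring V \<and> s \<notin> V"
  using place_valuation_ring(1) s_notin by (auto simp: \<Omega>_def)

lemma P_in_\<Omega>: "P \<in> \<Omega>" using P_place z_notin_P by (simp add: \<Omega>_def)

lemma odd_m: "odd m" using m_mod_8 by presburger

text \<open>Elements of \<open>T0\<close>, \<open>T1\<close>, \<open>T2\<close> are divisible by 8,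
  4, 2 respectively, while \<open>4 * m\<close>, \<open>2 * m\<close>, \<open>3 * m\<close> are not,
  since \<open>m\<close> is odd.\<close>

lemma disj0: "r \<in> T0 \<Longrightarrow> r' \<in> T0 \<Longrightarrow> r \<noteq> r' + 4 * int m"
proof -
  assume "r \<in> T0" "r' \<in> T0"
  then have "r mod 8 = 0" "r' mod 8 = 0" by (auto simp: T0_def)
  then show ?thesis using odd_m by presburger
qed

lemma T1_dvd: "r \<in> T1 \<Longrightarrow> 4 dvd r"
  by (auto simp: T1_def T0_def)

lemma T2_dvd: "r \<in> T2 \<Longrightarrow> even r"
  using dvd_trans[OF _ T1_dvd, of 2] by (auto simp: T2_def)

lemma disj1: "r \<in> T1 \<Longrightarrow> r' \<in> T1 \<Longrightarrow> r \<noteq> r' + 2 * int m"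
proof
  assume "r \<in> T1" "r' \<in> T1" "r = r' + 2 * int m"
  then have "4 dvd 2 * int m" using T1_dvd dvd_diff[of 4 r r'] by simp
  then show False using odd_m by presburger
qed

lemma disj2: "r \<in> T2 \<Longrightarrow> r' \<in> T2 \<Longrightarrow> r \<noteq> r' + 3 * int m"
  using T2_dvd[of r] T2_dvd[of r'] odd_m by auto

text \<open>The exponents \<open>l\<close> of \<open>w\<close> and \<open>j\<close> of
  \<open>y\<close> are the binary digits of the index \<open>2 * l + j\<close>, which runs from 0 to
  3.\<close>

lemma T3_semigroup: "T3 \<subseteq> int ` ggs_semigroup m"
proof
  fix r assume "r \<in> T3"
  then obtain r2 i where i: "r2 \<in> T2" "r = r2 + 3 * int m * int i" "i \<le> 1"
    unfolding T3_def by (elim UnE imageE) (use that[of _ 0] that[of _ 1] in auto)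
  obtain r1 j where j: "r1 \<in> T1" "r2 = r1 + 2 * int m * int j" "j \<le> 1"
    using i(1) unfolding T2_def by (elim UnE imageE) (use that[of _ 0] that[of _ 1] in auto)
  obtain r0 l where l: "r0 \<in> T0" "r1 = r0 + 4 * int m * int l" "l \<le> 1"
    using j(1) unfolding T1_def by (elim UnE imageE) (use that[of _ 0] that[of _ 1] in auto)
  obtain k where "r0 = 8 * int k" using l(1) by (auto simp: T0_def)
  then have r: "r = 8 * int k + 4 * int m * int l + 2 * int m * int j + 3 * int m * int i"
    using i j l by simp
  note le = i(3) j(3) l(3)
  have "r = int (3 * i * m + 2 * (2 * l + j) * m + 8 * k)" by (simp add: r algebra_simps)
  moreover have "3 * i * m + 2 * (2 * l + j) * m + 8 * k \<in> ggs_semigroup m"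
    unfolding ggs_semigroup_def using le by (intro CollectI exI[of _ i] exI[of _ "2 * l + j"] exI[of _ k]) auto
  ultimately show "r \<in> int ` ggs_semigroup m" by blast
qed

lemma rings: "subring B0 amb" "subring B1 amb" "subring B2 amb" "subring A amb"
  and rels: "w ^ 2 + w \<in> B0" "y ^ 2 + y \<in> B1" "x ^ 2 + x \<in> B2"
  and subsets: "B0 \<subseteq> B1" "B1 \<subseteq> B2" "B2 \<subseteq> A"
proof -
  show B0: "subring B0 amb" unfolding B0_def by (rule subring_adjoin[OF K_ring])
  have "z \<in> B0" unfolding B0_def by (rule mem_adjoin[OF K_ring])
  then show w: "w ^ 2 + w \<in> B0" unfolding w_rel by (rule subring_power[OF B0])
  show B1: "subring B1 amb" and "B0 \<subseteq> B1"
    unfolding B1_def by (rule subring_ext[OF B0 w], rule subset_ext[OF B0 w])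
  show y: "y ^ 2 + y \<in> B1"
    using generator_mem_ext[OF B0 w] by (simp add: B1_def w_def)
  show B2: "subring B2 amb" and "B1 \<subseteq> B2"
    unfolding B2_def by (rule subring_ext[OF B1 y], rule subset_ext[OF B1 y])
  show x: "x ^ 2 + x \<in> B2"
    using generator_mem_ext[OF B1 y] subring_power[OF B2] by (simp add: B2_def x_rel)
  show "subring A amb" and "B2 \<subseteq> A"
    unfolding A_def by (rule subring_ext[OF B2 x], rule subset_ext[OF B2 x])
qed

lemma degrees0: "has_degrees_in \<Omega> s B0 T0"
  unfolding has_degrees_in_def
proof (intro ballI impI)
  fix f assume "f \<in> B0" "f \<noteq> 0"
  then obtain p where p: "p \<in> polys_over K" "f = poly p z" by (auto simp: B0_def adjoin_def)
  then have "p \<noteq> 0" using \<open>f \<noteq> 0\<close> by auto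
  have "has_degree V s f (int (degree p) * 8)" if V: "V \<in> \<Omega>" for V
  proof -
    note val = \<Omega>(1)[OF V] s_notin[OF \<Omega>(1)[OF V] \<Omega>(2)[OF V]]
    have "K \<subseteq> V" using V place_valuation_ring(2) by (auto simp: \<Omega>_def)
    then have "has_degree V z f (int (degree p))"
      using has_degree_poly[OF K \<Omega>(1)[OF V] _ \<Omega>(2)[OF V]] p \<open>p \<noteq> 0\<close> by simp
    then have "f / z ^ degree p \<in> place_units V" by (simp add: has_degree_def)
    then show ?thesis
      by (rule has_degree_cong_unit[OF val has_degree_power[OF val degree_z[OF \<Omega>(1,2)[OF V]]]])
  qed
  then show "\<exists>r\<in>T0. \<forall>V\<in>\<Omega>. has_degree V s f r"
    by (intro bexI[of _ "int (degree p) * 8"]) (auto simp: T0_def)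
qed

lemma degrees1: "has_degrees_in \<Omega> s B1 T1"
  unfolding B1_def T1_def using degree_w \<Omega> by (intro has_degrees_in_ext degrees0 disj0) auto

lemma degrees2: "has_degrees_in \<Omega> s B2 T2"
  unfolding B2_def T2_def using degree_y \<Omega> by (intro has_degrees_in_ext degrees1 disj1) auto

lemma degrees_A: "has_degrees_in \<Omega> s A T3"
  unfolding A_def T3_def using degree_x \<Omega> by (intro has_degrees_in_ext degrees2 disj2) auto

lemma P_val: "valuation_ring P" "s \<notin> P"
  using \<Omega>(3)[OF P_in_\<Omega>] by auto

lemma closed_A: "almost_integrally_closed B0 A"
proof -
  note free = has_degrees_in_free[OF P_val _ P_in_\<Omega>]
  note deg = degree_w[OF P_val(1) z_notin_P] degree_y[OF P_val(1) z_notin_P] degree_x[OF P_val(1) z_notin_P]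
  have "almost_integrally_closed B0 B0"
    unfolding B0_def
    using almost_integrally_closed_polynomials[OF two K P_val(1) place_valuation_ring(2)[OF P_place] z_notin_P] .
  then have "almost_integrally_closed B0 B1"
    unfolding B1_def
    by (intro almost_integrally_closed_ext[OF two rings(1) rels(1) rings(1)] order_refl)
      (rule free[OF degrees0 deg(1) disj0], assumption+)
  then have "almost_integrally_closed B0 B2"
    unfolding B2_def
    by (intro almost_integrally_closed_ext[OF two rings(2) rels(2) rings(1) subsets(1)])
      (rule free[OF degrees1 deg(2) disj1], assumption+)
  then show "almost_integrally_closed B0 A"
    unfolding A_def using subsets
    by (intro almost_integrally_closed_ext[OF two rings(3) rels(3) rings(1)])
      (blast, rule free[OF degrees2 deg(3) disj2], assumption+)
qed

lemma B0_subset_A: "B0 \<subseteq> A" using subsets by blast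

text \<open>The norms down the tower make these fractions a field, and it contains \<open>K\<close>,
  \<open>x\<close>, \<open>y\<close> and \<open>z\<close>.\<close>

lemma fractions_A: "fractions A B0 = UNIV"
proof -
  have "has_multiples_in B0 B0"
    unfolding has_multiples_in_def
  proof (intro ballI impI)
    fix b assume "b \<in> B0" "b \<noteq> 0"
    then show "\<exists>c\<in>B0. b * c \<in> B0 \<and> b * c \<noteq> 0"
      using subring_one[OF rings(1)] by (intro bexI[of _ 1]) auto
  qed
  then have mult: "has_multiples_in B0 A"
    unfolding A_def B2_def B1_def
    by (intro has_multiples_in_ext[OF two] rings(1) rels(1) rings(2,3)[unfolded B2_def B1_def]
        rels(2,3)[unfolded B2_def B1_def])
  note frac = fractions_subfield[OF rings(4) rings(1) B0_subset_A mult]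
  have "K \<subseteq> A" "z \<in> A"
    using subset_adjoin[OF K_ring, of z] mem_adjoin[OF K_ring, of z] B0_subset_A by (auto simp: B0_def)
  moreover have "y \<in> A"
    using generator_mem_ext[OF rings(2) rels(2)] subsets by (auto simp: B2_def)
  moreover have "x \<in> A" using generator_mem_ext[OF rings(3) rels(3)] by (simp add: A_def)
  ultimately have "K \<union> {x, y, z} \<subseteq> fractions A B0" using frac(3) by blast
  moreover have "generate_field amb (K \<union> {x, y, z}) = UNIV"
    using ff by (simp only: ggs_function_field_def)
  ultimately show ?thesis
    using frac(2) by (intro generate_field_amb_eq_UNIV[OF _ frac(1)])
qed

lemma regular_mem_A:
  assumes "\<And>Q. Q \<in> places K \<Longrightarrow> z \<in> Q \<Longrightarrow> f \<in> Q"
  shows "f \<in> A"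
proof (rule mem_of_mem_valuation_rings[OF rings(4) rings(1) B0_subset_A closed_A])
  show "f \<in> fractions A B0" by (simp add: fractions_A)
  fix V :: "'a set" assume V: "valuation_ring V" "A \<subseteq> V"
  have B0: "K \<subseteq> B0" "z \<in> B0"
    using subset_adjoin[OF K_ring] mem_adjoin[OF K_ring] by (auto simp: B0_def)
  \<comment> \<open>This makes the inclusion of \<open>K\<close> in \<open>V\<close> strict, as
    \<open>places\<close> demands; only \<open>V = UNIV\<close> then fails to be a place.\<close>
  have "z \<notin> K" using z_notin_P place_valuation_ring(2)[OF P_place] by blast
  then have "V = UNIV \<or> V \<in> places K"
    using V B0 B0_subset_A by (auto simp: places_def valuation_ring_def)
  then show "f \<in> V" using assms B0 B0_subset_A V by blast
qed

lemma ex_degree: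
  assumes "f \<noteq> 0"
  shows "\<exists>r. \<forall>V\<in>\<Omega>. has_degree V s f r"
proof -
  have "f \<in> fractions A B0" by (simp add: fractions_A)
  then obtain g h where gh: "g \<in> A" "h \<in> B0" "h \<noteq> 0" "f = g / h" "g \<noteq> 0"
    using assms by (auto simp: fractions_def)
  then obtain r r' where "\<forall>V\<in>\<Omega>. has_degree V s g r" "\<forall>V\<in>\<Omega>. has_degree V s h r'"
    using degrees_A degrees0 by (meson has_degrees_in_def)
  then have "\<forall>V\<in>\<Omega>. has_degree V s f (r - r')"
    unfolding gh(4) using \<Omega>(3) has_degree_divide by blast
  then show ?thesis by blast
qed

text \<open>The degree of \<open>f\<close> is the same at all places in \<open>\<Omega>\<close>, and
  its sign decides membership of \<open>f\<close>, so these places are equal as sets.\<close>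

lemma place_at_infinity_unique:
  assumes "Q \<in> places K" "z \<notin> Q"
  shows "Q = P"
proof -
  have Q: "Q \<in> \<Omega>" using assms by (simp add: \<Omega>_def)
  have "f \<in> Q \<longleftrightarrow> f \<in> P" for f
  proof (cases "f = 0")
    case True
    then show ?thesis using V_closed(4) P_val(1) \<Omega>(1)[OF Q] by blast
  next
    case False
    then obtain r where r: "\<forall>V\<in>\<Omega>. has_degree V s f r" using ex_degree by blast
    have "V \<in> \<Omega> \<Longrightarrow> f \<in> V \<longleftrightarrow> r \<le> 0" for V
      using r \<Omega>(3) has_degree_mem_iff by blast
    then show ?thesis using Q P_in_\<Omega> by blast
  qed
  then show ?thesis by blast
qed

lemma P_degree: "f \<noteq> 0 \<Longrightarrow> \<exists>r. has_degree P s f r"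
  using ex_degree P_in_\<Omega> by blast

text \<open>A uniformizer \<open>t\<close> divides the nonunit \<open>1 / s\<close> of degree -1.
  Both factors have degree at most 0, and that of \<open>t\<close> is not 0, so it is -1.\<close>

lemma uniformizer_iff_degree: "uniformizer P t \<longleftrightarrow> has_degree P s t (- 1)"
proof
  have inv: "has_degree P s (inverse s) (- 1)"
    using has_degree_divide[OF P_val has_degree_power[OF P_val has_degree_self[OF P_val], of 0] has_degree_self[OF P_val]]
    by (simp add: divide_inverse)
  assume t: "uniformizer P t"
  have "inverse s \<in> P - place_units P"
    using has_degree_mem_iff[OF P_val inv] has_degree_unique[OF P_val inv, of 0]
    by (auto simp: has_degree_unit_iff[OF P_val])
  then obtain v where v: "inverse s = t * v" "v \<in> P" using t by (auto simp: uniformizer_def)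
  have "t = t * 1" by simp
  then have "t \<in> P - place_units P" using t V_closed(1)[OF P_val(1)] unfolding uniformizer_def by blast
  moreover have nz: "t \<noteq> 0" "v \<noteq> 0" using v s_nonzero[OF P_val] by auto
  then obtain r r' where r: "has_degree P s t r" "has_degree P s v r'" using P_degree by blast
  then have "r + r' = - 1" using has_degree_unique[OF P_val has_degree_mult[OF P_val r]] inv v by simp
  moreover have "r' \<le> 0" using has_degree_mem_iff[OF P_val r(2)] v by simp
  moreover have "r \<le> 0" "r \<noteq> 0"
    using calculation(1) has_degree_mem_iff[OF P_val r(1)] r(1) has_degree_unit_iff[OF P_val] by auto
  ultimately have "r = - 1" by linarith
  then show "has_degree P s t (- 1)" using r by simp
next
  assume t: "has_degree P s t (- 1)"
  note t0 = has_degree_nonzero[OF P_val t]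
  show "uniformizer P t"
    unfolding uniformizer_def
  proof (intro subset_antisym subsetI)
    fix f assume f: "f \<in> P - place_units P"
    show "f \<in> {t * v |v. v \<in> P}"
    proof (cases "f = 0")
      case True
      then show ?thesis using V_closed(4)[OF P_val(1)] by (intro CollectI exI[of _ 0]) auto
    next
      case False
      then obtain r where r: "has_degree P s f r" using P_degree by blast
      have "r \<le> 0" "r \<noteq> 0"
        using f has_degree_mem_iff[OF P_val r] r has_degree_unit_iff[OF P_val] by auto
      then have "f / t \<in> P"
        using has_degree_mem_iff[OF P_val has_degree_divide[OF P_val r t]] by simp
      then show ?thesis using t0 by (intro CollectI exI[of _ "f / t"]) auto
    qed
  next
    fix f assume "f \<in> {t * v |v. v \<in> P}"
    then obtain v where v: "f = t * v" "v \<in> P" by blast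
    have "t \<in> P" using has_degree_mem_iff[OF P_val t] by simp
    then have "f \<in> P" using v V_closed(3)[OF P_val(1)] by simp
    moreover have "f \<notin> place_units P"
    proof
      assume u: "f \<in> place_units P"
      then have "v \<noteq> 0" using v by (auto simp: place_units_def)
      then obtain r where r: "has_degree P s v r" using P_degree by blast
      have "- 1 + r = 0"
        using has_degree_unique[OF P_val has_degree_mult[OF P_val t r], of 0] u v
        by (simp add: has_degree_unit_iff[OF P_val])
      then show False using has_degree_mem_iff[OF P_val r] v by simp
    qed
    ultimately show "f \<in> P - place_units P" by blast
  qed
qed

text \<open>By uniqueness of \<open>P\<close>, the other places are exactly those where
  \<open>z\<close> is regular. The condition at \<open>P\<close> is the same for every uniformizer,
  and \<open>1 / s\<close> is one.\<close>

lemma has_pole_divisor_iff: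
  "has_pole_divisor K f r P \<longleftrightarrow> has_degree P s f (int r) \<and> (\<forall>Q\<in>places K. z \<in> Q \<longrightarrow> f \<in> Q)"
proof -
  have "places K - {P} = {Q \<in> places K. z \<in> Q}"
    using place_at_infinity_unique z_notin_P by blast
  moreover have "f * t ^ r \<in> place_units P \<longleftrightarrow> has_degree P s f (int r)" if "has_degree P s t (- 1)" for t
  proof -
    have t: "has_degree P s (t ^ r) (- int r)" "t \<noteq> 0"
      using has_degree_power[OF P_val that, of r] has_degree_nonzero[OF P_val that] by simp_all
    show ?thesis
      using has_degree_mult[OF P_val _ t(1), of f "int r"] has_degree_divide[OF P_val _ t(1), of "f * t ^ r" 0] t(2)
      by (auto simp: has_degree_unit_iff[OF P_val])
  qed
  moreover have "has_degree P s (inverse s) (- 1)"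
    using has_degree_divide[OF P_val has_degree_power[OF P_val has_degree_self[OF P_val], of 0] has_degree_self[OF P_val]]
    by (simp add: divide_inverse)
  ultimately show ?thesis
    unfolding has_pole_divisor_def uniformizer_iff_degree by auto
qed

text \<open>A function regular away from \<open>P\<close> lies in \<open>A\<close>, so its degree is
  in \<open>T3\<close>. Conversely the monomials \<open>x ^ i * y ^ j * z ^ k\<close> realize every
  element.\<close>

theorem weierstrass_semigroup_ggs: "weierstrass_semigroup K P = ggs_semigroup m"
proof (intro subset_antisym subsetI)
  fix r assume "r \<in> weierstrass_semigroup K P"
  then obtain f where f: "has_degree P s f (int r)" "\<And>Q. Q \<in> places K \<Longrightarrow> z \<in> Q \<Longrightarrow> f \<in> Q"
    by (auto simp: weierstrass_semigroup_def has_pole_divisor_iff)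
  then have "f \<in> A" by (intro regular_mem_A)
  moreover have "f \<noteq> 0" using has_degree_nonzero[OF P_val f(1)] .
  ultimately obtain r' where "r' \<in> T3" "has_degree P s f r'"
    using degrees_A P_in_\<Omega> by (auto simp: has_degrees_in_def)
  then have "int r \<in> int ` ggs_semigroup m"
    using has_degree_unique[OF P_val f(1)] T3_semigroup by blast
  then show "r \<in> ggs_semigroup m" by auto
next
  fix r assume "r \<in> ggs_semigroup m"
  then obtain i j k where r: "r = 3 * i * m + 2 * j * m + 8 * k" by (auto simp: ggs_semigroup_def)
  note PV = P_val(1) z_notin_P
  have "has_degree P s (x ^ i * y ^ j * z ^ k) (int i * (3 * int m) + int j * (2 * int m) + int k * 8)"
    by (intro has_degree_mult[OF P_val] has_degree_power[OF P_val] degree_x[OF PV] degree_y[OF PV] degree_z[OF PV])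
  moreover have "int i * (3 * int m) + int j * (2 * int m) + int k * 8 = int r"
    by (simp add: r)
  moreover have "x ^ i * y ^ j * z ^ k \<in> Q" if "Q \<in> places K" "z \<in> Q" for Q
  proof -
    note Q = place_valuation_ring(1)[OF that(1)]
    show ?thesis using mem_of_z_mem[OF Q that(2)] that(2) by (simp add: V_closed[OF Q])
  qed
  ultimately show "r \<in> weierstrass_semigroup K P"
    by (auto simp: weierstrass_semigroup_def has_pole_divisor_iff)
qed

end

section \<open>Decompositions in the semigroup\<close>

text \<open>For \<open>m mod 8 = 3\<close>, the multiples \<open>apery_coeff r * m\<close> form the
  Apery set with respect to 8: the least element of the semigroup in each residue class
  \<open>r\<close>.\<close>

definition apery_coeff :: "nat \<Rightarrow> nat" where
  "apery_coeff r = [0, 3, 6, 9, 4, 7, 2, 5] ! r"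

lemma mod_8_sum: "(\<Sum>r<8. f r) = f 0 + f 1 + f 2 + f 3 + f 4 + f 5 + f 6 + f (7::nat)"
  for f :: "nat \<Rightarrow> nat"
  by (simp add: eval_nat_numeral)

lemma apery_coeff_simps [simp]:
  "apery_coeff 0 = 0" "apery_coeff (Suc 0) = 3" "apery_coeff 1 = 3" "apery_coeff 2 = 6" "apery_coeff 3 = 9"
  "apery_coeff 4 = 4" "apery_coeff 5 = 7" "apery_coeff 6 = 2" "apery_coeff 7 = 5"
  by (simp_all add: apery_coeff_def eval_nat_numeral)

lemma apery_coeff_mod:
  assumes "m mod 8 = 3" "r < 8"
  shows "apery_coeff r * m mod 8 = r"
proof -
  have "apery_coeff r * m mod 8 = apery_coeff r * 3 mod 8"
    by (metis assms(1) mod_mult_right_eq)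
  then show ?thesis
    using less_8_cases[OF assms(2)] by auto
qed

text \<open>The eight numbers \<open>3 * i + 2 * j\<close> multiplied by 3 meet each residue modulo
  8 exactly once, so the residue of \<open>s\<close> determines \<open>i\<close> and
  \<open>j\<close>.\<close>

lemma mem_ggs_semigroup_iff:
  assumes "m mod 8 = 3"
  shows "s \<in> ggs_semigroup m \<longleftrightarrow> apery_coeff (s mod 8) * m \<le> s"
proof
  assume "s \<in> ggs_semigroup m"
  then obtain i j k where s: "s = 3 * i * m + 2 * j * m + 8 * k" and ij: "i \<le> 1" "j \<le> 3"
    unfolding ggs_semigroup_def by blast
  have c: "(3 * i + 2 * j) * m mod 8 = (3 * i + 2 * j) * 3 mod 8"
    by (metis assms mod_mult_right_eq)
  have "s = (3 * i + 2 * j) * m + 8 * k"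
    unfolding s by (simp add: algebra_simps)
  then have "s mod 8 = (3 * i + 2 * j) * m mod 8"
    by simp
  then have c: "s mod 8 = (3 * i + 2 * j) * 3 mod 8" using c by simp
  have "i \<in> {0, 1}" "j \<in> {0, 1, 2, 3}" using ij by auto
  then show "apery_coeff (s mod 8) * m \<le> s"
    unfolding c unfolding s by auto
next
  assume le: "apery_coeff (s mod 8) * m \<le> s"
  define r where "r = s mod 8"
  have r: "r < 8" by (simp add: r_def)
  have "8 dvd s - apery_coeff r * m"
    using le apery_coeff_mod[OF assms r] mod_eq_dvd_iff_nat[of "apery_coeff r * m" s 8]
    by (simp add: r_def)
  then obtain k where "s - apery_coeff r * m = 8 * k" by auto
  then have s: "s = apery_coeff r * m + 8 * k" using le by (simp add: r_def)
  have "\<exists>i j. i \<le> 1 \<and> j \<le> 3 \<and> apery_coeff r = 3 * i + 2 * j"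
    using less_8_cases[OF r] by (auto intro: exI[of _ 0] exI[of _ 1] exI[of _ 2] exI[of _ 3])
  then obtain i j where ij: "i \<le> 1" "j \<le> 3" "apery_coeff r = 3 * i + 2 * j" by blast
  show "s \<in> ggs_semigroup m"
    unfolding ggs_semigroup_def s using ij by (auto simp: algebra_simps)
qed

text \<open>The members are \<open>A + 8 * i\<close>, and the summand 8 accounts for both endpoints.
  If the interval is empty, the congruence forces \<open>A + B\<close> to be at least
  \<open>s + 8\<close>, so truncated subtraction gives 0.\<close>

lemma card_residue_class_interval:
  fixes A B s :: nat
  assumes "(A + B) mod 8 = s mod 8"
  shows "card {a. a mod 8 = A mod 8 \<and> A \<le> a \<and> a + B \<le> s} = (s + 8 - (A + B)) div 8"
proof -
  have "{a. a mod 8 = A mod 8 \<and> A \<le> a \<and> a + B \<le> s}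
      \<subseteq> (\<lambda>i. A + 8 * i) ` {..<(s + 8 - (A + B)) div 8}"
  proof
    fix a assume a: "a \<in> {a. a mod 8 = A mod 8 \<and> A \<le> a \<and> a + B \<le> s}"
    then have "8 dvd a - A" using mod_eq_dvd_iff_nat[of A a 8] by simp
    then obtain i where "a - A = 8 * i" by auto
    then have "a = A + 8 * i" using a by auto
    then show "a \<in> (\<lambda>i. A + 8 * i) ` {..<(s + 8 - (A + B)) div 8}"
      using a by auto
  qed
  moreover have "(\<lambda>i. A + 8 * i) ` {..<(s + 8 - (A + B)) div 8}
      \<subseteq> {a. a mod 8 = A mod 8 \<and> A \<le> a \<and> a + B \<le> s}"
    by auto
  moreover have "inj_on (\<lambda>i. A + 8 * i) Y" for Y by (auto intro: inj_onI)
  ultimately show ?thesis by (simp add: card_image)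
qed

text \<open>The numbers \<open>nu\<close>, indexed by the semigroup element instead of its
  position.\<close>

definition decompositions :: "nat set \<Rightarrow> nat \<Rightarrow> nat" where
  "decompositions H s = card {(a, b). a \<in> H \<and> b \<in> H \<and> a + b = s}"

lemma d_ORD_eqI:
  assumes inf: "infinite H" and s: "s \<in> H" "rho H (l + 1) \<le> s" "decompositions H s = d"
    and min: "\<And>s. s \<in> H \<Longrightarrow> rho H (l + 1) \<le> s \<Longrightarrow> d \<le> decompositions H s"
  shows "d_ORD H l = d"
proof -
  \<comment> \<open>The shift \<open>r + 1\<close> in \<open>nu\<close> cancels against the 1-based
    numbering of \<open>rho\<close>.\<close>
  have nu: "nu H r = decompositions H (enumerate H r)" for r
    by (simp add: nu_def rho_def decompositions_def)
  have "\<exists>r. enumerate H r = s" using enumerate_Ex[OF inf s(1)] .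
  then obtain r where r: "enumerate H r = s" by blast
  then have "l \<le> r" using s(2) inf by (auto simp: rho_def)
  then have "d \<in> {nu H r |r. l \<le> r}" using r s(3) nu by auto
  moreover have "d \<le> n" if "n \<in> {nu H r |r. l \<le> r}" for n
    using that min enumerate_in_set[OF inf] enumerate_mono_le_iff[OF inf]
    by (auto simp: nu rho_def)
  ultimately show ?thesis
    unfolding d_ORD_def by (rule cInf_eq_minimum)
qed

text \<open>The residue \<open>r\<close> of \<open>a\<close> fixes that of \<open>b\<close>, and
  membership of both becomes a pair of bounds on \<open>a\<close>. The sum of the two Apery
  coefficients exceeds that of \<open>c\<close> by \<open>8 * d\<close>, which costs
  \<open>d * m\<close> of the \<open>j + 1\<close> possible pairs.\<close>

lemma decompositions_eq:
  assumes m: "m mod 8 = 3" and c: "c < 8"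
  shows "decompositions (ggs_semigroup m) (apery_coeff c * m + 8 * j)
    = (\<Sum>r<8. j + 1 - (apery_coeff r + apery_coeff ((c + 8 - r) mod 8) - apery_coeff c) div 8 * m)"
proof -
  define s where "s = apery_coeff c * m + 8 * j"
  have sc: "s mod 8 = c" using apery_coeff_mod[OF m c] by (simp add: s_def)
  let ?X = "\<lambda>r. {a. a mod 8 = r \<and> apery_coeff r * m \<le> a \<and> a + apery_coeff ((c + 8 - r) mod 8) * m \<le> s}"
  have res: "(s - a) mod 8 = (c + 8 - a mod 8) mod 8" if "a \<le> s" for a
  proof -
    have "c = ((s - a) mod 8 + a mod 8) mod 8"
      using sc that by (simp add: mod_add_eq)
    then show ?thesis
      using less_8_cases[of "(s - a) mod 8"] less_8_cases[of "a mod 8"] by auto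
  qed
  have "{(a, b). a \<in> ggs_semigroup m \<and> b \<in> ggs_semigroup m \<and> a + b = s}
      = (\<lambda>a. (a, s - a)) ` {a. a \<le> s \<and> a \<in> ggs_semigroup m \<and> s - a \<in> ggs_semigroup m}"
    by auto
  then have "decompositions (ggs_semigroup m) s = card {a. a \<le> s \<and> a \<in> ggs_semigroup m \<and> s - a \<in> ggs_semigroup m}"
    by (simp add: decompositions_def card_image inj_on_def)
  also have "{a. a \<le> s \<and> a \<in> ggs_semigroup m \<and> s - a \<in> ggs_semigroup m} = (\<Union>r<8. ?X r)"
    by (auto simp: mem_ggs_semigroup_iff[OF m] res)
  also have "card \<dots> = (\<Sum>r<8. card (?X r))"
  proof (rule card_UN_disjoint)
    show "\<forall>r\<in>{..<8}. finite (?X r)"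
      by (auto intro: finite_subset[of _ "{..s}"])
  qed auto
  also have "\<dots> = (\<Sum>r<8. j + 1 - (apery_coeff r + apery_coeff ((c + 8 - r) mod 8) - apery_coeff c) div 8 * m)"
  proof (rule sum.cong)
    fix r :: nat assume "r \<in> {..<8}"
    then have r: "r < 8" by simp
    let ?A = "apery_coeff r" and ?B = "apery_coeff ((c + 8 - r) mod 8)" and ?C = "apery_coeff c"
    have A: "?A * m mod 8 = r" using apery_coeff_mod[OF m r] .
    have B: "?B * m mod 8 = (c + 8 - r) mod 8" using apery_coeff_mod[OF m] by simp
    have "(r + (c + 8 - r) mod 8) mod 8 = (?A * m + ?B * m) mod 8"
      using mod_add_eq[of "?A * m" 8 "?B * m"] unfolding A B .
    then have AB: "(?A * m + ?B * m) mod 8 = s mod 8"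
      using r c sc by (simp add: mod_add_right_eq)
    have "card (?X r) = (s + 8 - (?A * m + ?B * m)) div 8"
      using card_residue_class_interval[OF AB] by (simp add: A)
    moreover have "?C \<le> ?A + ?B \<and> (?A + ?B - ?C) mod 8 = 0"
      using less_8_cases[OF r] less_8_cases[OF c] by auto
    then obtain d where d: "?A + ?B = ?C + 8 * d"
      by (metis dvd_def le_add_diff_inverse mod_0_imp_dvd)
    moreover have "?A * m + ?B * m = ?C * m + 8 * (d * m)"
      using arg_cong[OF d, of "\<lambda>x. x * m"] by (simp add: algebra_simps)
    moreover have "8 * j + 8 - 8 * (d * m) = 8 * (j + 1 - d * m)"
      by (simp add: diff_mult_distrib2)
    ultimately show "card (?X r) = j + 1 - (?A + ?B - ?C) div 8 * m"
      by (simp add: s_def)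
  qed simp
  finally show ?thesis by (simp add: s_def)
qed

text \<open>Each of the eight residues of \<open>a\<close> contributes \<open>j + 1\<close>,
  \<open>j + 1 - m\<close> or \<open>j + 1 - 2 * m\<close>, truncated at 0; the coefficients count
  how often each occurs.\<close>

lemma decompositions_cases:
  assumes m: "m mod 8 = 3"
  shows "decompositions (ggs_semigroup m) (8 * j) = (j + 1) + 5 * (j + 1 - m) + 2 * (j + 1 - 2 * m)"
    and "decompositions (ggs_semigroup m) (9 * m + 8 * j) = 8 * (j + 1)"
    and "decompositions (ggs_semigroup m) (2 * m + 8 * j) = 2 * (j + 1) + 5 * (j + 1 - m) + (j + 1 - 2 * m)"
    and "decompositions (ggs_semigroup m) (3 * m + 8 * j) = 2 * (j + 1) + 6 * (j + 1 - m)"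
    and "decompositions (ggs_semigroup m) (4 * m + 8 * j) = 3 * (j + 1) + 5 * (j + 1 - m)"
    and "decompositions (ggs_semigroup m) (5 * m + 8 * j) = 4 * (j + 1) + 4 * (j + 1 - m)"
    and "decompositions (ggs_semigroup m) (6 * m + 8 * j) = 5 * (j + 1) + 3 * (j + 1 - m)"
    and "decompositions (ggs_semigroup m) (7 * m + 8 * j) = 6 * (j + 1) + 2 * (j + 1 - m)"
proof -
  note eq = decompositions_eq[OF m, unfolded mod_8_sum]
  show "decompositions (ggs_semigroup m) (8 * j) = (j + 1) + 5 * (j + 1 - m) + 2 * (j + 1 - 2 * m)"
    using eq[of 0 j] by simp
  show "decompositions (ggs_semigroup m) (9 * m + 8 * j) = 8 * (j + 1)"
    using eq[of 3 j] by simp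
  show "decompositions (ggs_semigroup m) (2 * m + 8 * j) = 2 * (j + 1) + 5 * (j + 1 - m) + (j + 1 - 2 * m)"
    using eq[of 6 j] by simp
  show "decompositions (ggs_semigroup m) (3 * m + 8 * j) = 2 * (j + 1) + 6 * (j + 1 - m)"
    using eq[of 1 j] by simp
  show "decompositions (ggs_semigroup m) (4 * m + 8 * j) = 3 * (j + 1) + 5 * (j + 1 - m)"
    using eq[of 4 j] by simp
  show "decompositions (ggs_semigroup m) (5 * m + 8 * j) = 4 * (j + 1) + 4 * (j + 1 - m)"
    using eq[of 7 j] by simp
  show "decompositions (ggs_semigroup m) (6 * m + 8 * j) = 5 * (j + 1) + 3 * (j + 1 - m)"
    using eq[of 2 j] by simp
  show "decompositions (ggs_semigroup m) (7 * m + 8 * j) = 6 * (j + 1) + 2 * (j + 1 - m)"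
    using eq[of 5 j] by simp
qed

text \<open>One case per residue class. The lower bound on \<open>s\<close> is rounded to an
  integral bound on \<open>j\<close> using \<open>m = 8 * q + 3\<close>, which leaves only linear
  arithmetic.\<close>

lemma decompositions_above:
  fixes m q k s :: nat
  assumes m: "m = 8 * q + 3" and s: "s \<in> ggs_semigroup m" "5 * m + 8 * k \<le> s"
  defines "N \<equiv> decompositions (ggs_semigroup m) s"
  obtains j where "k + 5 * q + 2 \<le> j" "N = (j + 1) + 5 * (j + 1 - m) + 2 * (j + 1 - 2 * m)"
  | j where "k \<le> j + 4 * q + 1" "N = 8 * j + 8"
  | j where "k + 3 * q + 2 \<le> j" "N = 2 * j + 2 + 5 * (j + 1 - m) + (j + 1 - 2 * m)"
  | j where "k + 2 * q + 1 \<le> j" "N = 2 * j + 2 + 6 * (j + 1 - m)"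
  | j where "k + q + 1 \<le> j" "N = 3 * j + 3 + 5 * (j + 1 - m)"
  | j where "k \<le> j" "N = 4 * j + 4 + 4 * (j + 1 - m)"
  | j where "k \<le> j + q" "N = 5 * j + 5 + 3 * (j + 1 - m)"
  | j where "k \<le> j + 2 * q" "N = 6 * j + 6 + 2 * (j + 1 - m)"
proof -
  have m8: "m mod 8 = 3" by (simp add: m)
  define c where "c = s mod 8"
  have "8 dvd s - apery_coeff c * m" "apery_coeff c * m \<le> s"
    using s(1) mem_ggs_semigroup_iff[OF m8] apery_coeff_mod[OF m8, of c]
      mod_eq_dvd_iff_nat[of "apery_coeff c * m" s 8]
    by (auto simp: c_def)
  then obtain j where j: "s = apery_coeff c * m + 8 * j"
    by (metis dvd_def le_add_diff_inverse)
  note dec = decompositions_cases[OF m8, of j]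
  have "c < 8" by (simp add: c_def)
  from less_8_cases[OF this] have "c = 0 \<or> c = 1 \<or> c = 2 \<or> c = 3 \<or> c = 4 \<or> c = 5 \<or> c = 6 \<or> c = 7"
    by simp
  then show thesis
  proof (elim disjE)
    assume "c = 0"
    then have sj: "s = 8 * j" using j by simp
    show thesis
      by (rule that(1)[of j]) (use s(2) sj m in simp, simp add: N_def sj dec)
  next
    assume "c = 1"
    then have sj: "s = 3 * m + 8 * j" using j by simp
    show thesis
      by (rule that(4)[of j]) (use s(2) sj m in simp, simp add: N_def sj dec)
  next
    assume "c = 2"
    then have sj: "s = 6 * m + 8 * j" using j by simp
    show thesis
      by (rule that(7)[of j]) (use s(2) sj m in simp, simp add: N_def sj dec)
  next
    assume "c = 3"
    then have sj: "s = 9 * m + 8 * j" using j by simp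
    show thesis
      by (rule that(2)[of j]) (use s(2) sj m in simp, simp add: N_def sj dec)
  next
    assume "c = 4"
    then have sj: "s = 4 * m + 8 * j" using j by simp
    show thesis
      by (rule that(5)[of j]) (use s(2) sj m in simp, simp add: N_def sj dec)
  next
    assume "c = 5"
    then have sj: "s = 7 * m + 8 * j" using j by simp
    show thesis
      by (rule that(8)[of j]) (use s(2) sj m in simp, simp add: N_def sj dec)
  next
    assume "c = 6"
    then have sj: "s = 2 * m + 8 * j" using j by simp
    show thesis
      by (rule that(3)[of j]) (use s(2) sj m in simp, simp add: N_def sj dec)
  next
    assume "c = 7"
    then have sj: "s = 5 * m + 8 * j" using j by simp
    show thesis
      by (rule that(6)[of j]) (use s(2) sj m in simp, simp add: N_def sj dec)
  qed
qed

text \<open>Within a class the count does not decrease with \<open>j\<close>, so the first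
  admissible element of each class is decisive. As \<open>k\<close> grows, \<open>6 * m\<close>,
  \<open>7 * m\<close> and \<open>9 * m\<close> successively fall below the threshold and the
  minimum moves to another class.\<close>

lemma ggs_order_bound:
  fixes m q k l :: nat
  assumes m: "m = 8 * q + 3" and q: "1 \<le> q" and km: "k < m"
    and H: "H = ggs_semigroup m"
    and rho: "rho H (l + 1) = 5 * m + 8 * k"
  shows "k = 0 \<Longrightarrow> d_ORD H l = 4"
    and "1 \<le> k \<Longrightarrow> k \<le> q \<Longrightarrow> d_ORD H l = 5"
    and "q < k \<Longrightarrow> k \<le> 2 * q \<Longrightarrow> d_ORD H l = 6"
    and "2 * q < k \<Longrightarrow> k \<le> 4 * q + 1 \<Longrightarrow> d_ORD H l = 8"
    and "4 * q + 2 \<le> k \<Longrightarrow> k \<le> 6 * q \<Longrightarrow> d_ORD H l = 8 * (k - 4 * q)"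
    and "6 * q + 1 \<le> k \<Longrightarrow> k \<le> 8 * q + 1 \<Longrightarrow> d_ORD H l = 8 * k - (32 * q + 2)"
    and "k = 8 * q + 2 \<Longrightarrow> d_ORD H l = 4 * m"
proof -
  have m8: "m mod 8 = 3" by (simp add: m)
  note dec = decompositions_cases[OF m8]
  have mem: "w * m + 8 * j \<in> H" if "w \<in> {3, 5, 6, 7, 9}" for w j
  proof -
    have "\<exists>i1 j1. i1 \<le> 1 \<and> j1 \<le> 3 \<and> w = 3 * i1 + 2 * j1"
      using that by (auto intro: exI[of _ 0] exI[of _ 1] exI[of _ 2] exI[of _ 3])
    then obtain i1 j1 where "i1 \<le> 1" "j1 \<le> 3" "w * m = 3 * i1 * m + 2 * j1 * m"
      by (auto simp: algebra_simps)
    then show ?thesis unfolding H ggs_semigroup_def by auto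
  qed
  have "inj (\<lambda>j. 3 * m + 8 * j)" by (auto intro: injI)
  then have "infinite (range (\<lambda>j. 3 * m + 8 * j))" by (rule range_inj_infinite)
  moreover have "range (\<lambda>j. 3 * m + 8 * j) \<subseteq> H" using mem[of 3] by auto
  ultimately have inf: "infinite H" using infinite_super by blast
  \<comment> \<open>The two arguments given to \<open>eqI\<close> below are the Apery coefficient
    and the offset of an element where the minimum is attained.\<close>
  note eqI = d_ORD_eqI[OF inf mem, where l = l, unfolded rho, unfolded H]
  show "d_ORD H l = 4" if "k = 0"
    unfolding H
  proof (rule eqI[of 5 "0"])
    fix s assume "s \<in> ggs_semigroup m" "5 * m + 8 * k \<le> s"
    from decompositions_above[OF m this]
    show "4 \<le> decompositions (ggs_semigroup m) s"
      by cases (use that q in linarith)+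
  qed (use that dec(6)[of "0"] m in auto)
  show "d_ORD H l = 5" if "1 \<le> k" "k \<le> q"
    unfolding H
  proof (rule eqI[of 6 "0"])
    fix s assume "s \<in> ggs_semigroup m" "5 * m + 8 * k \<le> s"
    from decompositions_above[OF m this]
    show "5 \<le> decompositions (ggs_semigroup m) s"
      by cases (use that km m q in linarith)+
  qed (use that dec(7)[of "0"] m in auto)
  show "d_ORD H l = 6" if "q < k" "k \<le> 2 * q"
    unfolding H
  proof (rule eqI[of 7 "0"])
    fix s assume "s \<in> ggs_semigroup m" "5 * m + 8 * k \<le> s"
    from decompositions_above[OF m this]
    show "6 \<le> decompositions (ggs_semigroup m) s"
      by cases (use that km m q in linarith)+
  qed (use that dec(8)[of "0"] m in auto)
  show "d_ORD H l = 8" if "2 * q < k" "k \<le> 4 * q + 1"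
    unfolding H
  proof (rule eqI[of 9 "0"])
    fix s assume "s \<in> ggs_semigroup m" "5 * m + 8 * k \<le> s"
    from decompositions_above[OF m this]
    show "8 \<le> decompositions (ggs_semigroup m) s"
      by cases (use that km m q in linarith)+
  qed (use that dec(2)[of "0"] m in auto)
  show "d_ORD H l = 8 * (k - 4 * q)" if "4 * q + 2 \<le> k" "k \<le> 6 * q"
    unfolding H
  \<comment> \<open>The least admissible offset above \<open>9 * m\<close>, because
    \<open>4 * m = 8 * (4 * q + 1) + 4\<close>.\<close>
  proof (rule eqI[of 9 "k - 4 * q - 1"])
    fix s assume "s \<in> ggs_semigroup m" "5 * m + 8 * k \<le> s"
    from decompositions_above[OF m this]
    show "8 * (k - 4 * q) \<le> decompositions (ggs_semigroup m) s"
      by cases (use that km m q in linarith)+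
  qed (use that dec(2)[of "k - 4 * q - 1"] m in auto)
  show "d_ORD H l = 8 * k - (32 * q + 2)" if "6 * q + 1 \<le> k" "k \<le> 8 * q + 1"
    unfolding H
  \<comment> \<open>The least admissible offset above \<open>3 * m\<close>, because
    \<open>2 * m = 8 * (2 * q) + 6\<close>. Here \<open>k\<close> is large enough that
    \<open>j + 1 - m\<close> is not truncated.\<close>
  proof (rule eqI[of 3 "k + 2 * q + 1"])
    fix s assume "s \<in> ggs_semigroup m" "5 * m + 8 * k \<le> s"
    from decompositions_above[OF m this]
    show "8 * k - (32 * q + 2) \<le> decompositions (ggs_semigroup m) s"
      by cases (use that km m q in linarith)+
  qed (use that dec(4)[of "k + 2 * q + 1"] m in auto)
  show "d_ORD H l = 4 * m" if "k = 8 * q + 2"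
    unfolding H
  proof (rule eqI[of 5 "k"])
    fix s assume "s \<in> ggs_semigroup m" "5 * m + 8 * k \<le> s"
    from decompositions_above[OF m this]
    show "4 * m \<le> decompositions (ggs_semigroup m) s"
      by cases (use that km m q in linarith)+
  qed (use that dec(6)[of "k"] m in auto)
qed

section \<open>The order bound of the one-point codes\<close>

theorem lemma3p6:
  fixes K P :: "'a::field set" and x y z :: 'a and n m k l :: nat and H :: "nat set"
  assumes "5 \<le> n" and "odd n"
    and "m = (2 ^ n + 1) div 3"
    and "ggs_function_field n K x y z"
    and "point_at_infinity K x y z P"
    and "H = weierstrass_semigroup K P"
    and "1 \<le> l" and "k < m"
    and "rho H (l + 1) = 5 * m + 8 * k"
  shows
    "(k = 0 \<longrightarrow> d_ORD H l = 4) \<and>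
     (1 \<le> k \<and> int k \<le> \<lfloor>real m / 8\<rfloor> \<longrightarrow> d_ORD H l = 5) \<and>
     (real m / 8 < real k \<and> int k \<le> \<lfloor>real m / 4\<rfloor> \<longrightarrow> d_ORD H l = 6) \<and>
     (real m / 4 < real k \<and> int k \<le> \<lfloor>real m / 2\<rfloor> \<longrightarrow> d_ORD H l = 8) \<and>
     (\<lceil>real m / 2\<rceil> \<le> int k \<and> int k \<le> \<lfloor>3 * real m / 4\<rfloor> - 2 \<longrightarrow>
        int (d_ORD H l) = 8 * (\<lceil>real k - real m / 2\<rceil> + 1)) \<and>
     (\<lfloor>3 * real m / 4\<rfloor> - 1 \<le> int k \<and> int k \<le> int m - 2 \<longrightarrow>
        int (d_ORD H l) = 2 * (\<lceil>real m / 4 + real k\<rceil> + 1)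
                        + 6 * (\<lceil>real m / 4 + real k\<rceil> - int m + 1)) \<and>
     (int k = int m - 1 \<longrightarrow> d_ORD H l = 4 * m)"
proof -
  interpret ggs_curve n m K x y z P
    using assms by unfold_locales
  have H: "H = ggs_semigroup m"
    using assms(6) weierstrass_semigroup_ggs by simp
  define q where "q = m div 8"
  have mq: "m = 8 * q + 3" using m_mod_8 by (simp add: q_def) presburger
  have q: "1 \<le> q" using m_ge mq by linarith
  have rm: "real m = 8 * real q + 3" by (simp add: mq)
  \<comment> \<open>The remainder 3 of \<open>m\<close> modulo 8 settles every rounding, so all case
    limits become linear in \<open>q\<close>; the fifth and sixth ranges meet at
    \<open>6 * q\<close> and \<open>6 * q + 1\<close>.\<close>
  have floors: "\<lfloor>real m / 8\<rfloor> = int q" "\<lfloor>real m / 4\<rfloor> = 2 * int q" "\<lfloor>real m / 2\<rfloor> = 4 * int q + 1"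
    "\<lfloor>3 * real m / 4\<rfloor> = 6 * int q + 2" "\<lceil>real m / 2\<rceil> = 4 * int q + 2"
    "\<lceil>real k - real m / 2\<rceil> = int k - 4 * int q - 1"
    "\<lceil>real m / 4 + real k\<rceil> = 2 * int q + 1 + int k"
    using rm by linarith+
  have less: "real m / 8 < real k \<longleftrightarrow> q < k" "real m / 4 < real k \<longleftrightarrow> 2 * q < k"
    using rm by linarith+
  note bound = ggs_order_bound[OF mq q assms(8) H assms(9)]
  show ?thesis
    unfolding floors less
  proof (intro conjI impI, goal_cases)
    case 1
    then show ?case by (rule bound(1))
  next
    case 2
    then show ?case by (intro bound(2)) simp_all
  next
    case 3
    then show ?case by (intro bound(3)) simp_all
  next
    case 4
    then show ?case by (intro bound(4)) simp_all
  next
    case 5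
    then have "4 * q + 2 \<le> k" "k \<le> 6 * q" by linarith+
    then show ?case using bound(5) by simp
  next
    case 6
    then have "6 * q + 1 \<le> k" "k \<le> 8 * q + 1" using mq by linarith+
    then show ?case using bound(6) mq by simp
  next
    case 7
    then have "k = 8 * q + 2" using mq by linarith
    then show ?case by (rule bound(7))
  qed
qed

end
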